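(* Let $v$ be a typical weight on the open unit disk $\mathbb{D}$ and let $(z_n)_{n\in\mathbb{N}}\subset\mathbb{D}$ be a sequence. (a) $(z_n)$ is interpolating for $\mathcal{B}_v^\infty$ (i.e. for every $(a_n)\in\ell_\infty$ there is $f\in\mathcal{B}_v^\infty$ with $v(z_n)f'(z_n)=a_n$ for all $n$) if and only if it is $c_0$-interpolating for $\mathcal{B}_v^0$ (i.e. for every $(a_n)\in c_0$ there is $f\in\mathcal{B}_v^0$ with $v(z_n)f'(z_n)=a_n$ for all $n$). (b) Assume $|z_n|\to1$, and let $T:\mathcal{B}_v^\infty\to\ell_\infty$ be the interpolating operator $T(f)=(v(z_n)f'(z_n))_{n}$, whose restriction $T|_{\mathcal{B}_v^0}$ maps $\mathcal{B}_v^0$ into $c_0$. Then, under the identifications $(\mathcal{B}_v^0)^{**}=\mathcal{B}_v^\infty$ and $c_0^{**}=\ell_\infty$ described in the context, $(T|_{\mathcal{B}_v^0})^{**}=T$, and $T$ is $w^*$-$w^*$-continuous.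
   Context: $\mathbb{D}$ is the open unit disk of $\mathbb{C}$ and $H(\mathbb{D})$ is the space of complex analytic functions on $\mathbb{D}$. A weight $v$ is a strictly positive continuous function on $\mathbb{D}$; it is typical if it is radial ($v(z)=v(|z|)$ for all $z\in\mathbb{D}$), non-increasing (in $|z|$), and $\lim_{|z|\to1}v(z)=0$. The Bloch type spaces are $$\mathcal{B}_v^\infty=\{f\in H(\mathbb{D}):\ \|f\|_{\mathcal{B}_v^\infty}:=|f(0)|+\sup_{z\in\mathbb{D}}v(z)|f'(z)|<\infty\},\qquad \mathcal{B}_v^0=\{f\in\mathcal{B}_v^\infty:\ \lim_{|z|\to1^-}v(z)|f'(z)|=0\}.$$ $\widetilde{\mathcal{B}}_v^\infty$ and $\widetilde{\mathcal{B}}_v^0$ are the closed subspaces of $\mathcal{B}_v^\infty$ and $\mathcal{B}_v^0$, respectively, of functions with $f(0)=0$. Let ${}^*\widetilde{\mathcal{B}}_v^\infty$ be the space of all $\ell\in(\widetilde{\mathcal{B}}_v^\infty)^*$ whose restriction to the closed unit ball of $\widetilde{\mathcal{B}}_v^\infty$ is continuous for the compact-open topology, with the norm of $(\widetilde{\mathcal{B}}_v^\infty)^*$, and put ${}^*\mathcal{B}_v^\infty:=({}^*\widetilde{\mathcal{B}}_v^\infty\times\mathbb{C},\|\cdot\|_\infty)$ (maximum of the two norms), where $(\ell,c)$ acts on $f\in\mathcal{B}_v^\infty$ by $(\ell,c)(f)=\ell(f-f(0))+c\,f(0)$. Identifications: restriction of functionals from $\mathcal{B}_v^\infty$ to $\mathcal{B}_v^0$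 identifies ${}^*\mathcal{B}_v^\infty$ isometrically with $(\mathcal{B}_v^0)^*$, and the map sending $f\in\mathcal{B}_v^\infty$ to the functional $u\mapsto u(f)$ on ${}^*\mathcal{B}_v^\infty$ identifies $\mathcal{B}_v^\infty$ isometrically with $({}^*\mathcal{B}_v^\infty)^*$, hence with $(\mathcal{B}_v^0)^{**}$. Likewise $c_0^*=\ell_1$ and $\ell_1^*=\ell_\infty$ via the usual pairings. The $w^*$-topologies are $\sigma(\mathcal{B}_v^\infty,{}^*\mathcal{B}_v^\infty)$ on $\mathcal{B}_v^\infty$ and $\sigma(\ell_\infty,\ell_1)$ on $\ell_\infty$. *)

theory Defs
  imports "HOL-Analysis.Analysis"
begin

text \<open>
  The weight is a term variable, so the spaces depending on it cannot be types. Every space below is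
  a carrier set of complex-valued functions with pointwise operations. A function (or functional)
  given on a proper subset of its type is made total by the value 0 off that subset, so that equality
  in HOL is equality on the intended domain.
\<close>

subsection \<open>Duals, adjoints, weak-star topologies\<close>

definition dual_space ::
  "('a \<Rightarrow> complex) set \<Rightarrow> (('a \<Rightarrow> complex) \<Rightarrow> real) \<Rightarrow> (('a \<Rightarrow> complex) \<Rightarrow> complex) set" where
  "dual_space V N = {\<phi>.
     (\<forall>f\<in>V. \<forall>g\<in>V. \<phi> (\<lambda>x. f x + g x) = \<phi> f + \<phi> g) \<and>
     (\<forall>c. \<forall>f\<in>V. \<phi> (\<lambda>x. c * f x) = c * \<phi> f) \<and>
     (\<exists>C. \<forall>f\<in>V. cmod (\<phi> f) \<le> C * N f) \<and>
     (\<forall>f. f \<notin> V \<longrightarrow> \<phi> f = 0)}"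

text \<open>
  The adjoint of the operator \<open>S\<close> restricted to the domain \<open>V\<close>. A functional on functionals is
  again of the form \<open>('b \<Rightarrow> complex) \<Rightarrow> complex\<close>, so the construction can be iterated.
\<close>

definition op_adjoint ::
  "('a \<Rightarrow> complex) set \<Rightarrow> (('a \<Rightarrow> complex) \<Rightarrow> ('b \<Rightarrow> complex)) \<Rightarrow>
   (('b \<Rightarrow> complex) \<Rightarrow> complex) \<Rightarrow> (('a \<Rightarrow> complex) \<Rightarrow> complex)" where
  "op_adjoint V S \<psi> = (\<lambda>f. if f \<in> V then \<psi> (S f) else 0)"

text \<open>The adjoint of the adjoint of \<open>S : V \<rightarrow> (W, M)\<close>.\<close>

definition op_biadjoint ::
  "('a \<Rightarrow> complex) set \<Rightarrow> ('b \<Rightarrow> complex) set \<Rightarrow> (('b \<Rightarrow> complex) \<Rightarrow> real) \<Rightarrow>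
   (('a \<Rightarrow> complex) \<Rightarrow> ('b \<Rightarrow> complex)) \<Rightarrow>
   ((('a \<Rightarrow> complex) \<Rightarrow> complex) \<Rightarrow> complex) \<Rightarrow> ((('b \<Rightarrow> complex) \<Rightarrow> complex) \<Rightarrow> complex)" where
  "op_biadjoint V W M S = op_adjoint (dual_space W M) (op_adjoint V S)"

definition restrict_functional ::
  "('p \<Rightarrow> ('a \<Rightarrow> complex) \<Rightarrow> complex) \<Rightarrow> ('a \<Rightarrow> complex) set \<Rightarrow> 'p \<Rightarrow> (('a \<Rightarrow> complex) \<Rightarrow> complex)" where
  "restrict_functional pair V u = (\<lambda>f. if f \<in> V then pair u f else 0)"

text \<open>
  Let \<open>P\<close> act through \<open>pair\<close> on a space containing \<open>V\<close>, in such a way that \<open>restrict_functional pair V\<close>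
  identifies \<open>P\<close> with the dual of \<open>(V, N)\<close>. Then an element \<open>f\<close> of the larger space is identified with
  the element of the bidual of \<open>(V, N)\<close> that sends \<open>\<phi>\<close> to \<open>pair u f\<close>, where \<open>u \<in> P\<close> restricts to \<open>\<phi>\<close>.
\<close>

definition to_bidual ::
  "'p set \<Rightarrow> ('p \<Rightarrow> ('a \<Rightarrow> complex) \<Rightarrow> complex) \<Rightarrow> ('a \<Rightarrow> complex) set \<Rightarrow> (('a \<Rightarrow> complex) \<Rightarrow> real) \<Rightarrow>
   ('a \<Rightarrow> complex) \<Rightarrow> ((('a \<Rightarrow> complex) \<Rightarrow> complex) \<Rightarrow> complex)" where
  "to_bidual P pair V N f =
     (\<lambda>\<phi>. if \<phi> \<in> dual_space V N then pair (inv_into P (restrict_functional pair V) \<phi>) f else 0)"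

definition weak_star_topology ::
  "('a \<Rightarrow> complex) set \<Rightarrow> 'p set \<Rightarrow> ('p \<Rightarrow> ('a \<Rightarrow> complex) \<Rightarrow> complex) \<Rightarrow> ('a \<Rightarrow> complex) topology" where
  "weak_star_topology X P pair =
     topology_generated_by {{f \<in> X. pair u f \<in> U} | u U. u \<in> P \<and> open U}"

subsection \<open>Sequence spaces\<close>

definition ell_inf :: "(nat \<Rightarrow> complex) set" where
  "ell_inf = {a. bounded (range a)}"

definition c_zero :: "(nat \<Rightarrow> complex) set" where
  "c_zero = {a. a \<longlonglongrightarrow> 0}"

definition sup_norm :: "(nat \<Rightarrow> complex) \<Rightarrow> real" where
  "sup_norm a = (SUP n. cmod (a n))"

definition ell_one :: "(nat \<Rightarrow> complex) set" where
  "ell_one = {b. summable (\<lambda>n. cmod (b n))}"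

definition seq_pairing :: "(nat \<Rightarrow> complex) \<Rightarrow> (nat \<Rightarrow> complex) \<Rightarrow> complex" where
  "seq_pairing b a = (\<Sum>n. b n * a n)"

subsection \<open>Weights and Bloch type spaces\<close>

abbreviation unit_disk :: "complex set" where
  "unit_disk \<equiv> ball 0 1"

text \<open>The filter of \<open>z\<close> with \<open>|z| \<rightarrow> 1\<close> from inside the disk.\<close>

definition to_boundary :: "complex filter" where
  "to_boundary = filtercomap cmod (at_left 1)"

definition weight :: "(complex \<Rightarrow> real) \<Rightarrow> bool" where
  "weight v \<longleftrightarrow> continuous_on unit_disk v \<and> (\<forall>z\<in>unit_disk. 0 < v z)"

definition typical_weight :: "(complex \<Rightarrow> real) \<Rightarrow> bool" where
  "typical_weight v \<longleftrightarrow> weight v \<and>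
     (\<forall>z\<in>unit_disk. v z = v (complex_of_real (cmod z))) \<and>
     (\<forall>z\<in>unit_disk. \<forall>w\<in>unit_disk. cmod z \<le> cmod w \<longrightarrow> v w \<le> v z) \<and>
     (v \<longlongrightarrow> 0) to_boundary"

definition hol_disk :: "(complex \<Rightarrow> complex) set" where
  "hol_disk = {f. f holomorphic_on unit_disk \<and> (\<forall>z. z \<notin> unit_disk \<longrightarrow> f z = 0)}"

definition bloch_inf :: "(complex \<Rightarrow> real) \<Rightarrow> (complex \<Rightarrow> complex) set" where
  "bloch_inf v = {f \<in> hol_disk. bdd_above ((\<lambda>z. v z * cmod (deriv f z)) ` unit_disk)}"

definition bloch_norm :: "(complex \<Rightarrow> real) \<Rightarrow> (complex \<Rightarrow> complex) \<Rightarrow> real" where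
  "bloch_norm v f = cmod (f 0) + (SUP z\<in>unit_disk. v z * cmod (deriv f z))"

definition bloch_zero :: "(complex \<Rightarrow> real) \<Rightarrow> (complex \<Rightarrow> complex) set" where
  "bloch_zero v = {f \<in> bloch_inf v. ((\<lambda>z. v z * cmod (deriv f z)) \<longlongrightarrow> 0) to_boundary}"

definition bloch_inf_tilde :: "(complex \<Rightarrow> real) \<Rightarrow> (complex \<Rightarrow> complex) set" where
  "bloch_inf_tilde v = {f \<in> bloch_inf v. f 0 = 0}"

definition compact_open_topology :: "(complex \<Rightarrow> complex) topology" where
  "compact_open_topology =
     topology_generated_by
       {{f \<in> hol_disk. f ` K \<subseteq> U} | K U. compact K \<and> K \<subseteq> unit_disk \<and> open U}"

definition predual_tilde :: "(complex \<Rightarrow> real) \<Rightarrow> ((complex \<Rightarrow> complex) \<Rightarrow> complex) set" where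
  "predual_tilde v = {l \<in> dual_space (bloch_inf_tilde v) (bloch_norm v).
     continuous_map
       (subtopology compact_open_topology {f \<in> bloch_inf_tilde v. bloch_norm v f \<le> 1})
       euclidean l}"

text \<open>
  The predual of \<open>bloch_inf v\<close>. Its norm is left out, because neither the weak-star topology nor the
  map \<open>to_bidual\<close> depends on it.
\<close>

definition bloch_predual :: "(complex \<Rightarrow> real) \<Rightarrow> (((complex \<Rightarrow> complex) \<Rightarrow> complex) \<times> complex) set" where
  "bloch_predual v = predual_tilde v \<times> UNIV"

text \<open>\<open>(l, c)\<close> acts by \<open>f \<mapsto> l (f - f 0) + c * f 0\<close>, where \<open>f - f 0\<close> is again 0 off the disk.\<close>

definition bloch_pairing ::
  "((complex \<Rightarrow> complex) \<Rightarrow> complex) \<times> complex \<Rightarrow> (complex \<Rightarrow> complex) \<Rightarrow> complex" where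
  "bloch_pairing u f =
     fst u (\<lambda>z. if z \<in> unit_disk then f z - f 0 else 0) + snd u * f 0"

subsection \<open>Interpolation\<close>

definition interp_op ::
  "(complex \<Rightarrow> real) \<Rightarrow> (nat \<Rightarrow> complex) \<Rightarrow> (complex \<Rightarrow> complex) \<Rightarrow> (nat \<Rightarrow> complex)" where
  "interp_op v z f = (\<lambda>n. complex_of_real (v (z n)) * deriv f (z n))"

definition interpolating :: "(complex \<Rightarrow> real) \<Rightarrow> (nat \<Rightarrow> complex) \<Rightarrow> bool" where
  "interpolating v z \<longleftrightarrow>
     (\<forall>a\<in>ell_inf. \<exists>f\<in>bloch_inf v. \<forall>n. complex_of_real (v (z n)) * deriv f (z n) = a n)"

definition c0_interpolating :: "(complex \<Rightarrow> real) \<Rightarrow> (nat \<Rightarrow> complex) \<Rightarrow> bool" where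
  "c0_interpolating v z \<longleftrightarrow>
     (\<forall>a\<in>c_zero. \<exists>f\<in>bloch_zero v. \<forall>n. complex_of_real (v (z n)) * deriv f (z n) = a n)"

end

theory Submission
  imports Defs "HOL-Complex_Analysis.Great_Picard"
begin

text \<open>
  Differentiation reduces everything to holomorphic \<open>g = f'\<close> on the disk with \<open>v |g|\<close> bounded,
  or vanishing at the boundary, and to the weighted samples \<open>v(z\<^sub>n) g(z\<^sub>n)\<close>.

  Equivalence of the two interpolation properties. Each of them says in particular that every
  \<open>c\<^sub>0\<close> sequence is interpolated by some \<open>g\<close> with \<open>v |g|\<close> bounded. The sequences interpolated
  with bound \<open>k\<close> form a set that is closed under pointwise limits (Montel), so the Baire
  category theorem in \<open>c\<^sub>0\<close> provides a uniform constant, first for \<open>c\<^sub>0\<close> and then, by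
  truncation and a normal family argument, for all bounded sequences
  (\<open>uniform_interpolation_constant\<close>). This yields interpolation of \<open>\<ell>\<^sub>\<infinity>\<close>. To interpolate \<open>c\<^sub>0\<close>
  data by functions that vanish at the boundary, note first that \<open>|z\<^sub>n|\<close> tends to 1 by the
  identity theorem (\<open>interpolation_forces_boundary\<close>). Dilations \<open>g(r z)\<close> of a bounded
  interpolant vanish at the boundary, with the same bound as \<open>g\<close>, and their samples converge
  boundedly and pointwise to the data; averages of finitely many of them converge uniformly
  (\<open>vanishing_approximate_interpolation\<close>), and iterating on the residual gives an exact
  solution (\<open>vanishing_interpolation_by_successive_approximation\<close>).

  Second adjoint and weak-star continuity. For \<open>b\<close> in \<open>\<ell>\<^sub>1\<close> the functional
  \<open>f \<mapsto> \<Sum>n. b\<^sub>n v(z\<^sub>n) f'(z\<^sub>n)\<close> is compact-open continuous on the unit ball, hence belongs to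
  the predual (\<open>sample_functional_in_predual\<close>). Thus the interpolating operator pulls \<open>\<ell>\<^sub>1\<close>
  back into the predual, which is weak-star continuity. Elements of the predual are determined
  by their values on the small space, again by dilation
  (\<open>bloch_predual_determined_by_bloch_zero\<close>), and every functional on \<open>c\<^sub>0\<close> comes from \<open>\<ell>\<^sub>1\<close>
  (\<open>dual_of_c_zero_is_ell_one\<close>); together these compute the second adjoint.
\<close>

section \<open>Weighted growth balls and normal families\<close>

text \<open>
  The derivatives of the functions in a Bloch type space. Up to the value at 0, interpolation
  by \<open>v f'\<close> is interpolation by \<open>v g\<close> with \<open>g\<close> in one of these balls, so the interpolation
  problem can be treated without mentioning \<open>f\<close>.
\<close>

definition growth_ball :: "(complex \<Rightarrow> real) \<Rightarrow> real \<Rightarrow> (complex \<Rightarrow> complex) set" where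
  "growth_ball v C = {g. g holomorphic_on unit_disk \<and> (\<forall>w\<in>unit_disk. v w * cmod (g w) \<le> C)}"

definition samples ::
  "(complex \<Rightarrow> real) \<Rightarrow> (nat \<Rightarrow> complex) \<Rightarrow> (complex \<Rightarrow> complex) \<Rightarrow> (nat \<Rightarrow> complex)" where
  "samples v z g = (\<lambda>n. complex_of_real (v (z n)) * g (z n))"

lemma growth_ballD:
  assumes "g \<in> growth_ball v C"
  shows "g holomorphic_on unit_disk" "\<And>w. w \<in> unit_disk \<Longrightarrow> v w * cmod (g w) \<le> C"
  using assms by (auto simp: growth_ball_def)

lemma norm_samples_le:
  assumes "weight v" "\<forall>n. z n \<in> unit_disk" "g \<in> growth_ball v C"
  shows "cmod (samples v z g n) \<le> C"
proof -
  have "v (z n) > 0" "v (z n) * cmod (g (z n)) \<le> C"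
    using assms by (auto simp: weight_def growth_ball_def)
  then show ?thesis by (simp add: samples_def norm_mult)
qed

lemma weight_bounded_below_on_compact:
  assumes "weight v" "compact K" "K \<subseteq> unit_disk"
  obtains m where "m > 0" "\<And>w. w \<in> K \<Longrightarrow> m \<le> v w"
proof (cases "K = {}")
  case True
  then show ?thesis using that[of 1] by auto
next
  case False
  have "continuous_on K v"
    using assms continuous_on_subset by (auto simp: weight_def)
  then obtain x where x: "x \<in> K" "\<forall>y\<in>K. v x \<le> v y"
    using continuous_attains_inf[of K v] assms False by blast
  then show ?thesis
    using that[of "v x"] assms by (auto simp: weight_def)
qed

lemma growth_ball_bounded_on_compact:
  assumes "weight v" "compact K" "K \<subseteq> unit_disk"
  obtains B where "\<And>g w C. g \<in> growth_ball v C \<Longrightarrow> w \<in> K \<Longrightarrow> cmod (g w) \<le> B * C"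
proof -
  obtain m where m: "m > 0" "\<And>w. w \<in> K \<Longrightarrow> m \<le> v w"
    using weight_bounded_below_on_compact[OF assms] by blast
  have "cmod (g w) \<le> 1/m * C" if "g \<in> growth_ball v C" "w \<in> K" for g w C
  proof -
    have "m * cmod (g w) \<le> v w * cmod (g w)"
      using m(2)[OF that(2)] by (intro mult_right_mono) auto
    also have "\<dots> \<le> C"
      using growth_ballD[OF that(1)] that(2) assms by blast
    finally show ?thesis using m(1) by (simp add: field_simps)
  qed
  then show ?thesis by (rule that)
qed

text \<open>
  By Montel's theorem a growth ball is compact for locally uniform convergence. This is what
  lets interpolation of finitely supported data with a uniform bound pass to arbitrary bounded
  data, and what makes the sets in the Baire argument below closed.
\<close>

lemma growth_ball_samples_closed:
  assumes v: "weight v" and z: "\<forall>n. z n \<in> unit_disk"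
    and g: "\<And>j. g j \<in> growth_ball v C"
    and lim: "\<And>n. (\<lambda>j. samples v z (g j) n) \<longlonglongrightarrow> a n"
  obtains h where "h \<in> growth_ball v C" "samples v z h = a"
proof -
  obtain h r where h: "h holomorphic_on unit_disk" "strict_mono (r :: nat \<Rightarrow> nat)"
    "\<And>x. x \<in> unit_disk \<Longrightarrow> ((\<lambda>n. g (r n) x) \<longlongrightarrow> h x) sequentially"
  proof (rule Montel[where S=unit_disk and \<H>="growth_ball v C" and \<F>=g])
    fix K :: "complex set" assume "compact K" "K \<subseteq> unit_disk"
    then show "\<exists>B. \<forall>h\<in>growth_ball v C. \<forall>z\<in>K. cmod (h z) \<le> B"
      using growth_ball_bounded_on_compact[OF v] by metis
  qed (use g growth_ballD in auto)
  show ?thesis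
  proof
    have "v w * cmod (h w) \<le> C" if w: "w \<in> unit_disk" for w
    proof (rule LIMSEQ_le_const2)
      show "(\<lambda>n. v w * cmod (g (r n) w)) \<longlonglongrightarrow> v w * cmod (h w)"
        by (intro tendsto_intros h w)
      show "\<exists>N. \<forall>n\<ge>N. v w * cmod (g (r n) w) \<le> C"
        using growth_ballD(2)[OF g w] by auto
    qed
    then show "h \<in> growth_ball v C" using h(1) by (auto simp: growth_ball_def)
    show "samples v z h = a"
    proof
      fix n
      have "(\<lambda>j. samples v z (g (r j)) n) \<longlonglongrightarrow> samples v z h n"
        unfolding samples_def by (intro tendsto_intros h) (use z in auto)
      moreover have "(\<lambda>j. samples v z (g (r j)) n) \<longlonglongrightarrow> a n"
        using LIMSEQ_subseq_LIMSEQ[OF lim h(2), of n] by (simp add: o_def)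
      ultimately show "samples v z h n = a n" by (rule LIMSEQ_unique)
    qed
  qed
qed

section \<open>Uniform constants from the Baire category theorem\<close>

lemma truncation_in_c_zero: "(\<lambda>n. if n < N then a n else 0) \<in> c_zero"
  unfolding c_zero_def mem_Collect_eq
  by (rule tendsto_eventually) (auto simp: eventually_sequentially intro: exI[of _ N])

lemma truncation_tendsto: "(\<lambda>N. if n < N then a n else (0::complex)) \<longlonglongrightarrow> a n"
  by (rule tendsto_eventually) (auto simp: eventually_sequentially intro: exI[of _ "Suc n"])

text \<open>
  A substitute for the open mapping theorem. Some \<open>K k\<close> contains a ball of the Banach space
  \<open>c\<^sub>0\<close> by Baire; subtracting the centre and rescaling, a fixed \<open>K C\<close> contains the unit ball
  of \<open>c\<^sub>0\<close>. Since every sequence in the unit ball of \<open>\<ell>\<^sub>\<infinity>\<close> is the pointwise limit of its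
  truncations, which lie in \<open>c\<^sub>0\<close>, closedness under pointwise limits gives the whole unit ball
  of \<open>\<ell>\<^sub>\<infinity>\<close>.
\<close>

lemma uniform_constant_for_covers_of_c_zero:
  fixes K :: "nat \<Rightarrow> (nat \<Rightarrow> complex) set"
  assumes cover: "\<And>a. a \<in> c_zero \<Longrightarrow> \<exists>k. a \<in> K k"
    and closed: "\<And>k x a. (\<And>j. x j \<in> K k) \<Longrightarrow> (\<And>n. (\<lambda>j. x j n) \<longlonglongrightarrow> a n) \<Longrightarrow> a \<in> K k"
    and diff: "\<And>j k a b. a \<in> K j \<Longrightarrow> b \<in> K k \<Longrightarrow> (\<lambda>n. a n - b n) \<in> K (j + k)"
    and scale: "\<And>m k a. a \<in> K k \<Longrightarrow> (\<lambda>n. of_nat m * a n) \<in> K (m * k)"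
  obtains C where "\<And>a. (\<And>n. cmod (a n) \<le> 1) \<Longrightarrow> a \<in> K C"
proof -
  \<comment> \<open>\<open>S\<close> is \<open>c\<^sub>0\<close> inside the space of bounded (hence, on discrete \<open>nat\<close>, bounded continuous) functions.\<close>
  define S :: "(nat \<Rightarrow>\<^sub>C complex) set" where "S = {x. apply_bcontfun x \<in> c_zero}"
  define G where "G k = {x \<in> S. apply_bcontfun x \<in> K k}" for k
  have complete: "complete (UNIV :: (nat \<Rightarrow>\<^sub>C complex) set)"
  proof (rule completeI)
    fix f :: "nat \<Rightarrow> nat \<Rightarrow>\<^sub>C complex" assume "Cauchy f"
    then have "uniformly_Cauchy_on UNIV (\<lambda>j. apply_bcontfun (f j))"
      unfolding uniformly_Cauchy_on_def Cauchy_def by (meson dist_fun_lt_imp_dist_val_lt)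
    then obtain l where "uniform_limit UNIV (\<lambda>j. apply_bcontfun (f j)) l sequentially"
      using Cauchy_uniformly_convergent uniformly_convergent_on_def by blast
    then show "\<exists>l\<in>UNIV. f \<longlonglongrightarrow> l"
      by (metis UNIV_I sequentially_bot uniform_limit_bcontfunE)
  qed
  have ptw: "(\<lambda>j. apply_bcontfun (x j) n) \<longlonglongrightarrow> apply_bcontfun l n" if "x \<longlonglongrightarrow> l" for x l n
    using tendsto_bcontfun_uniform_limit[OF that] by (rule tendsto_uniform_limitI) auto
  have "closed S"
    unfolding closed_sequential_limits
  proof (intro allI impI, elim conjE)
    fix x l assume x: "\<forall>n. x n \<in> S" "x \<longlonglongrightarrow> l"
    show "l \<in> S"
      unfolding S_def c_zero_def mem_Collect_eq
    proof (rule swap_uniform_limit'[where g="\<lambda>j. 0" and F=sequentially and S=UNIV])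
      show "uniform_limit UNIV (\<lambda>j. apply_bcontfun (x j)) (apply_bcontfun l) sequentially"
        by (rule tendsto_bcontfun_uniform_limit[OF x(2)])
    qed (use x(1) in \<open>auto simp: S_def c_zero_def\<close>)
  qed
  then have cm: "completely_metrizable_space (top_of_set S)"
    using Met_TC.completely_metrizable_space_mtopology complete
    by (intro completely_metrizable_space_closedin) auto
  have clG: "closedin (top_of_set S) (G k)" for k
  proof -
    have "closed (G k)"
      unfolding closed_sequential_limits
    proof (intro allI impI, elim conjE)
      fix x l assume x: "\<forall>n. x n \<in> G k" "x \<longlonglongrightarrow> l"
      have "l \<in> S" using \<open>closed S\<close> x unfolding closed_sequential_limits G_def by blast
      moreover have "apply_bcontfun l \<in> K k"
        using closed[of "\<lambda>j. apply_bcontfun (x j)"] ptw[OF x(2)] x(1) by (auto simp: G_def)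
      ultimately show "l \<in> G k" by (simp add: G_def)
    qed
    then show ?thesis by (intro closed_subset) (auto simp: G_def)
  qed
  have union: "\<Union>(range G) = S" using cover by (auto simp: G_def S_def)
  have "0 \<in> S" by (simp add: S_def c_zero_def)
  have "\<exists>k. top_of_set S interior_of G k \<noteq> {}"
  proof (rule ccontr)
    assume "\<not> ?thesis"
    then have "top_of_set S interior_of \<Union>(range G) = {}"
      using clG by (intro Baire_category_alt disjI1 cm) auto
    then have "top_of_set S interior_of topspace (top_of_set S) = {}"
      using union by simp
    then show False using \<open>0 \<in> S\<close> by (simp only: interior_of_topspace) auto
  qed
  then obtain k T where T: "openin (top_of_set S) T" "T \<subseteq> G k" "T \<noteq> {}"
    by (auto simp: interior_of_def)
  then obtain x0 e where x0: "x0 \<in> S" "e > 0" "ball x0 e \<inter> S \<subseteq> G k"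
    unfolding openin_contains_ball by blast
  have x0K: "apply_bcontfun x0 \<in> K k"
    using x0 centre_in_ball[of x0 e] unfolding G_def by blast
  obtain m :: nat where m: "1 / real m < e / 2" "m > 0"
    using nat_approx_posE[of "e/2"] x0(2) by (metis half_gt_zero of_nat_Suc zero_less_Suc)
  have small: "a \<in> K (m * (k + k))" if a: "a \<in> c_zero" "\<And>n. cmod (a n) \<le> 1" for a
  proof -
    \<comment> \<open>\<open>a = m (b - x0)\<close>, where both \<open>b\<close> and the centre \<open>x0\<close> lie in \<open>K k\<close>.\<close>
    define b where "b = (\<lambda>n. apply_bcontfun x0 n + a n / of_nat m)"
    have "b \<longlonglongrightarrow> 0 + 0 / of_nat m"
      unfolding b_def using a(1) x0(1) m(2) by (intro tendsto_intros) (auto simp: S_def c_zero_def)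
    then have bc: "b \<in> c_zero" by (simp add: c_zero_def)
    then have "b \<in> bcontfun"
      by (auto simp: bcontfun_def c_zero_def intro: convergent_imp_bounded)
    then obtain y where y: "b = apply_bcontfun y" by (rule bcontfunE)
    have "dist x0 y \<le> e / 2"
    proof (rule dist_bound)
      fix n
      have "dist (apply_bcontfun x0 n) (apply_bcontfun y n) = cmod (a n) / m"
        unfolding y[symmetric] b_def by (simp add: dist_norm norm_divide)
      also have "\<dots> \<le> 1 / m" using a(2)[of n] by (simp add: divide_right_mono)
      finally show "dist (apply_bcontfun x0 n) (apply_bcontfun y n) \<le> e / 2" using m by simp
    qed
    then have "y \<in> ball x0 e \<inter> S" using x0(2) bc y by (auto simp: S_def)
    then have "b \<in> K k" using x0(3) y by (auto simp: G_def)
    then have "(\<lambda>n. of_nat m * (b n - apply_bcontfun x0 n)) \<in> K (m * (k + k))"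
      by (intro scale diff x0K)
    then show ?thesis using m(2) by (simp add: b_def)
  qed
  show ?thesis
  proof
    fix a :: "nat \<Rightarrow> complex" assume "\<And>n. cmod (a n) \<le> 1"
    then have "(\<lambda>n. if n < N then a n else 0) \<in> K (m * (k + k))" for N
      by (intro small truncation_in_c_zero) auto
    then show "a \<in> K (m * (k + k))"
      by (rule closed) (rule truncation_tendsto)
  qed
qed

lemma uniform_interpolation_constant:
  assumes v: "weight v" and z: "\<forall>n. z n \<in> unit_disk"
    and interp: "\<And>a. a \<in> c_zero \<Longrightarrow> \<exists>C. \<exists>g\<in>growth_ball v C. samples v z g = a"
  obtains C where "C > 0"
    "\<And>a s. s \<ge> 0 \<Longrightarrow> (\<And>n. cmod (a n) \<le> s) \<Longrightarrow> \<exists>g\<in>growth_ball v (C * s). samples v z g = a"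
proof -
  define K where "K k = samples v z ` growth_ball v (real k)" for k :: nat
  have pos: "0 < v w" if "w \<in> unit_disk" for w using v that by (auto simp: weight_def)
  obtain C where C: "\<And>a. (\<And>n. cmod (a n) \<le> 1) \<Longrightarrow> a \<in> K C"
  proof (rule uniform_constant_for_covers_of_c_zero[of K])
    fix a assume "a \<in> c_zero"
    then obtain C g where g: "g \<in> growth_ball v C" "samples v z g = a" using interp by blast
    have "g \<in> growth_ball v (real (nat \<lceil>C\<rceil>))"
      using g(1) real_nat_ceiling_ge[of C] by (fastforce simp: growth_ball_def intro: order_trans)
    then show "\<exists>k. a \<in> K k" using g(2) by (auto simp: K_def)
  next
    fix k and x :: "nat \<Rightarrow> nat \<Rightarrow> complex" and a :: "nat \<Rightarrow> complex"
    assume x: "\<And>j. x j \<in> K k" "\<And>n. (\<lambda>j. x j n) \<longlonglongrightarrow> a n"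
    then obtain g where g: "\<And>j. g j \<in> growth_ball v (real k)" "\<And>j. x j = samples v z (g j)"
      unfolding K_def image_iff by metis
    show "a \<in> K k"
      by (rule growth_ball_samples_closed[where g=g and a=a, OF v z g(1) x(2)[unfolded g(2)]])
        (auto simp: K_def)
  next
    fix j k a b assume "a \<in> K j" "b \<in> K k"
    then obtain g h where gh: "g \<in> growth_ball v j" "h \<in> growth_ball v k"
      "a = samples v z g" "b = samples v z h" by (auto simp: K_def)
    have "v w * cmod (g w - h w) \<le> real (j + k)" if w: "w \<in> unit_disk" for w
    proof -
      have "v w * cmod (g w - h w) \<le> v w * (cmod (g w) + cmod (h w))"
        using pos[OF w] by (intro mult_left_mono norm_triangle_ineq4) auto
      then show ?thesis
        using growth_ballD(2)[OF gh(1) w] growth_ballD(2)[OF gh(2) w] by (simp add: distrib_left)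
    qed
    then have "(\<lambda>w. g w - h w) \<in> growth_ball v (real (j + k))"
      using gh by (auto simp: growth_ball_def intro!: holomorphic_intros)
    moreover have "samples v z (\<lambda>w. g w - h w) = (\<lambda>n. a n - b n)"
      by (auto simp: gh samples_def algebra_simps)
    ultimately show "(\<lambda>n. a n - b n) \<in> K (j + k)" unfolding K_def by (metis imageI)
  next
    fix m k a assume "a \<in> K k"
    then obtain g where g: "g \<in> growth_ball v k" "a = samples v z g" by (auto simp: K_def)
    have "(\<lambda>w. of_nat m * g w) \<in> growth_ball v (real (m * k))"
      using g(1) by (auto simp: growth_ball_def norm_mult mult.left_commute[of _ "real m"]
          intro!: holomorphic_intros mult_left_mono)
    moreover have "samples v z (\<lambda>w. of_nat m * g w) = (\<lambda>n. of_nat m * a n)"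
      by (auto simp: g samples_def algebra_simps)
    ultimately show "(\<lambda>n. of_nat m * a n) \<in> K (m * k)" unfolding K_def by (metis imageI)
  qed blast
  show ?thesis
  proof
    show "real C + 1 > 0" by simp
    fix a :: "nat \<Rightarrow> complex" and s :: real assume s: "s \<ge> 0" "\<And>n. cmod (a n) \<le> s"
    show "\<exists>g\<in>growth_ball v ((real C + 1) * s). samples v z g = a"
    proof (cases "s = 0")
      case True
      then show ?thesis
        using s by (intro bexI[of _ "\<lambda>w. 0"]) (auto simp: growth_ball_def samples_def)
    next
      case False
      then have "(\<lambda>n. a n / of_real s) \<in> K C"
        using s by (intro C) (auto simp: norm_divide divide_simps)
      then obtain g where g: "g \<in> growth_ball v C" "samples v z g = (\<lambda>n. a n / of_real s)"
        by (auto simp: K_def)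
      have "v w * (s * cmod (g w)) \<le> (real C + 1) * s" if "w \<in> unit_disk" for w
      proof -
        have "s * (v w * cmod (g w)) \<le> s * (real C + 1)"
          using growth_ballD(2)[OF g(1) that] s by (intro mult_left_mono) auto
        then show ?thesis by (simp add: mult_ac)
      qed
      then have "(\<lambda>w. of_real s * g w) \<in> growth_ball v ((real C + 1) * s)"
        using g(1) s by (auto simp: growth_ball_def norm_mult intro!: holomorphic_intros)
      moreover have "samples v z (\<lambda>w. of_real s * g w) = a"
        using False g(2) by (auto simp: samples_def fun_eq_iff field_simps)
      ultimately show ?thesis by blast
    qed
  qed
qed

section \<open>From bounded to vanishing interpolants\<close>

text \<open>
  A gliding hump. The rows are chosen one after the other so that each new row is small at
  those \<open>n\<close> where the sum of the earlier ones is not yet small. At every \<open>n\<close> the accumulated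
  sum then exceeds its small contributions by at most one large term, which is at most \<open>B\<close>,
  and averaging over many rows makes the contribution of that term negligible. In this
  concrete situation it replaces Mazur's theorem (a weakly null sequence has convex
  combinations tending to 0 in norm).
\<close>

lemma average_of_null_sequences:
  fixes x :: "nat \<Rightarrow> nat \<Rightarrow> real"
  assumes nonneg: "\<And>k n. 0 \<le> x k n" and bound: "\<And>k n. x k n \<le> B" and "e > 0"
    and row: "\<And>k. x k \<longlonglongrightarrow> 0" and col: "\<And>n. (\<lambda>k. x k n) \<longlonglongrightarrow> 0"
  shows "\<exists>F. finite F \<and> F \<noteq> {} \<and> (\<forall>n. (\<Sum>k\<in>F. x k n) \<le> e * real (card F))"
proof -
  have "B \<ge> 0" using nonneg[of 0 0] bound[of 0 0] by linarith
  \<comment> \<open>At each \<open>n\<close> all rows but one contribute at most \<open>d\<close> each; \<open>B\<close> pays for the remaining one.\<close>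
  have "\<exists>F. finite F \<and> card F = M \<and> (\<forall>n. (\<Sum>k\<in>F. x k n) \<le> B + real M * d)" if "d > 0" for M d
  proof (induction M)
    case 0
    then show ?case using \<open>B \<ge> 0\<close> by (intro exI[of _ "{}"]) auto
  next
    case (Suc M)
    then obtain F where F: "finite F" "card F = M" "\<And>n. (\<Sum>k\<in>F. x k n) \<le> B + real M * d" by blast
    have "(\<lambda>n. \<Sum>k\<in>F. x k n) \<longlonglongrightarrow> (\<Sum>k\<in>F. 0)" by (intro tendsto_intros row)
    then have "\<forall>\<^sub>F n in sequentially. (\<Sum>k\<in>F. x k n) < d"
      using \<open>d > 0\<close> by (intro order_tendstoD(2)) auto
    then obtain N where N: "\<And>n. n \<ge> N \<Longrightarrow> (\<Sum>k\<in>F. x k n) < d"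
      by (auto simp: eventually_sequentially)
    have "\<forall>\<^sub>F k in sequentially. \<forall>n\<in>{..<N}. x k n < d"
      using col \<open>d > 0\<close> by (auto intro!: eventually_ball_finite order_tendstoD(2))
    moreover have "\<forall>\<^sub>F k in sequentially. k \<notin> F"
      using F(1) by (metis Max.coboundedI eventually_at_top_dense not_le)
    ultimately have "\<forall>\<^sub>F k in sequentially. k \<notin> F \<and> (\<forall>n\<in>{..<N}. x k n < d)"
      by eventually_elim auto
    then obtain k where k: "k \<notin> F" "\<forall>n\<in>{..<N}. x k n < d"
      by (auto simp: eventually_sequentially)
    have "(\<Sum>k\<in>insert k F. x k n) \<le> B + real (Suc M) * d" for n
    proof (cases "n < N")
      case True
      then have "x k n < d" using k(2) by blast
      then show ?thesis using k(1) F(1) F(3)[of n] by (simp add: algebra_simps)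
    next
      case False
      have "0 \<le> real M * d" using \<open>d > 0\<close> by simp
      then show ?thesis
        using k(1) F(1) N[of n] bound[of k n] False by (simp add: distrib_right)
    qed
    then show ?case using k F by (intro exI[of _ "insert k F"]) auto
  qed note average = this
  obtain M where M: "real M > 2 * B / e" using reals_Archimedean2 by blast
  have "e / 2 > 0" using \<open>e > 0\<close> by simp
  from average[OF this, of "Suc M"] obtain F where
    F: "finite F" "card F = Suc M" "\<And>n. (\<Sum>k\<in>F. x k n) \<le> B + real (Suc M) * (e / 2)" by blast
  have "B + real (Suc M) * (e / 2) \<le> e * real (Suc M)"
    using M \<open>e > 0\<close> by (simp add: field_simps)
  then show ?thesis using F by (intro exI[of _ F]) (auto intro: order_trans)
qed

lemma eventually_to_boundary:
  "eventually P to_boundary \<longleftrightarrow> (\<exists>r<1. \<forall>w. r < cmod w \<longrightarrow> cmod w < 1 \<longrightarrow> P w)"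
proof
  assume "eventually P to_boundary"
  then obtain Q where Q: "eventually Q (at_left 1)" "\<And>w. Q (cmod w) \<Longrightarrow> P w"
    by (auto simp: to_boundary_def eventually_filtercomap)
  then obtain r where "r < 1" "\<And>t. r < t \<Longrightarrow> t < 1 \<Longrightarrow> Q t"
    by (auto simp: eventually_at_left_field)
  then show "\<exists>r<1. \<forall>w. r < cmod w \<longrightarrow> cmod w < 1 \<longrightarrow> P w" using Q(2) by blast
next
  assume "\<exists>r<1. \<forall>w. r < cmod w \<longrightarrow> cmod w < 1 \<longrightarrow> P w"
  then obtain r where r: "r < 1" "\<And>w. r < cmod w \<Longrightarrow> cmod w < 1 \<Longrightarrow> P w" by blast
  have "eventually (\<lambda>t. r < t \<and> t < 1) (at_left (1::real))"
    unfolding eventually_at_left_field using r(1) by blast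
  then show "eventually P to_boundary"
    unfolding to_boundary_def eventually_filtercomap using r(2) by blast
qed

lemma eventually_in_disk_to_boundary: "\<forall>\<^sub>F w in to_boundary. w \<in> unit_disk"
  unfolding eventually_to_boundary by (intro exI[of _ 0]) auto

lemma filterlim_to_boundary:
  assumes "\<forall>n. z n \<in> unit_disk" "(\<lambda>n. cmod (z n)) \<longlonglongrightarrow> 1"
  shows "filterlim z to_boundary sequentially"
  unfolding to_boundary_def filterlim_filtercomap_iff o_def filterlim_at
  using assms by (auto simp: less_imp_neq)

text \<open>
  Stated without absolute values, so that the condition is visibly linear in \<open>g\<close>.
\<close>

definition vanishing_at_boundary :: "(complex \<Rightarrow> real) \<Rightarrow> (complex \<Rightarrow> complex) \<Rightarrow> bool" where
  "vanishing_at_boundary v g \<longleftrightarrow> ((\<lambda>w. complex_of_real (v w) * g w) \<longlongrightarrow> 0) to_boundary"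

lemma vanishing_at_boundary_iff_norm:
  assumes "weight v"
  shows "vanishing_at_boundary v g \<longleftrightarrow> ((\<lambda>w. v w * cmod (g w)) \<longlongrightarrow> 0) to_boundary"
proof -
  have "\<forall>\<^sub>F w in to_boundary. cmod (complex_of_real (v w) * g w) = v w * cmod (g w)"
    using eventually_in_disk_to_boundary
    by eventually_elim (use assms in \<open>auto simp: weight_def norm_mult less_imp_le\<close>)
  from tendsto_cong[OF this, of 0] show ?thesis
    by (simp add: vanishing_at_boundary_def tendsto_norm_zero_iff)
qed

lemma samples_in_c_zero:
  assumes "vanishing_at_boundary v g" "\<forall>n. z n \<in> unit_disk" "(\<lambda>n. cmod (z n)) \<longlonglongrightarrow> 1"
  shows "samples v z g \<in> c_zero"
  using filterlim_compose[OF assms(1)[unfolded vanishing_at_boundary_def]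
      filterlim_to_boundary[OF assms(2,3)]]
  by (simp add: c_zero_def samples_def)

lemma scaled_in_disk:
  assumes "0 \<le> r" "r \<le> 1" "w \<in> unit_disk"
  shows "complex_of_real r * w \<in> unit_disk" "cmod (complex_of_real r * w) \<le> cmod w"
proof -
  show *: "cmod (complex_of_real r * w) \<le> cmod w"
    using assms by (simp add: norm_mult mult_left_le_one_le)
  show "complex_of_real r * w \<in> unit_disk" using * assms(3) by simp
qed

lemma typical_weight_scaled_le:
  assumes "typical_weight v" "0 \<le> r" "r \<le> 1" "w \<in> unit_disk"
  shows "v w \<le> v (complex_of_real r * w)"
  using assms scaled_in_disk[OF assms(2-4)] unfolding typical_weight_def by blast

text \<open>
  Here the weight being radial and non-increasing enters: moving the point towards the centre
  can only increase the weight.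
\<close>

lemma dilation_in_growth_ball:
  assumes v: "typical_weight v" and r: "0 \<le> r" "r \<le> 1" and g: "g \<in> growth_ball v C"
  shows "(\<lambda>w. g (of_real r * w)) \<in> growth_ball v C"
proof -
  have "(\<lambda>w. g (of_real r * w)) holomorphic_on unit_disk"
    using scaled_in_disk[OF r]
    by (intro holomorphic_on_compose_gen[OF _ growth_ballD(1)[OF g], unfolded o_def]
        holomorphic_intros) auto
  moreover have "v w * cmod (g (of_real r * w)) \<le> C" if w: "w \<in> unit_disk" for w
  proof -
    have "v w * cmod (g (of_real r * w)) \<le> v (of_real r * w) * cmod (g (of_real r * w))"
      using typical_weight_scaled_le[OF v r w] by (intro mult_right_mono) auto
    also have "\<dots> \<le> C" using growth_ballD(2)[OF g] scaled_in_disk[OF r w] by blast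
    finally show ?thesis .
  qed
  ultimately show ?thesis by (simp add: growth_ball_def)
qed

text \<open>
  A dilated function is bounded on the whole disk, so the weight alone forces the product to
  0.
\<close>

lemma dilation_vanishing_at_boundary:
  assumes v: "typical_weight v" and r: "0 \<le> r" "r < 1" and g: "g holomorphic_on unit_disk"
  shows "vanishing_at_boundary v (\<lambda>w. g (of_real r * w))"
proof -
  have wv: "weight v" and v0: "(v \<longlongrightarrow> 0) to_boundary" using v by (auto simp: typical_weight_def)
  have "continuous_on (cball 0 r) g"
    using g r by (intro holomorphic_on_imp_continuous_on) (auto elim: holomorphic_on_subset)
  then have "bounded (g ` cball 0 r)"
    by (intro compact_imp_bounded compact_continuous_image) auto
  then obtain B where B: "\<And>w. w \<in> cball 0 r \<Longrightarrow> cmod (g w) \<le> B"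
    unfolding bounded_iff by blast
  have "((\<lambda>w. v w * cmod (g (of_real r * w))) \<longlongrightarrow> 0) to_boundary"
  proof (rule Lim_null_comparison)
    show "((\<lambda>w. v w * B) \<longlongrightarrow> 0) to_boundary"
      using tendsto_mult_right[OF v0, of B] by simp
    show "\<forall>\<^sub>F w in to_boundary. norm (v w * cmod (g (of_real r * w))) \<le> v w * B"
      using eventually_in_disk_to_boundary
    proof eventually_elim
      case (elim w)
      have "v w > 0" using wv elim by (auto simp: weight_def)
      moreover have "cmod (of_real r * w) \<le> r"
        using r elim by (simp add: norm_mult mult_left_le)
      ultimately show ?case using B by (auto simp: abs_mult intro!: mult_left_mono)
    qed
  qed
  then show ?thesis using vanishing_at_boundary_iff_norm[OF wv] by blast
qed

lemma radii_tendsto: "(\<lambda>k. 1 - inverse (real (Suc k))) \<longlonglongrightarrow> 1"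
  using tendsto_diff[OF tendsto_const LIMSEQ_inverse_real_of_nat, of 1] by simp

lemma radii_bounds: "0 \<le> 1 - inverse (real (Suc k))" "1 - inverse (real (Suc k)) < 1"
  by (auto simp: field_simps)

text \<open>
  The dilations of \<open>g\<close> vanish at the boundary and their samples converge to those of \<open>g\<close>,
  boundedly but in general only pointwise. As all the sequences of samples involved are null
  sequences, a suitable average of dilations has samples uniformly close to \<open>a\<close>; the average
  stays in the growth ball by convexity.
\<close>

lemma vanishing_approximate_interpolation:
  assumes v: "typical_weight v" and z: "\<forall>n. z n \<in> unit_disk"
    and z1: "(\<lambda>n. cmod (z n)) \<longlonglongrightarrow> 1" and g: "g \<in> growth_ball v C"
    and a: "samples v z g = a" "a \<in> c_zero" and "e > 0"
  obtains h where "h \<in> growth_ball v C" "vanishing_at_boundary v h"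
    "\<And>n. cmod (samples v z h n - a n) \<le> e"
proof -
  have wv: "weight v" using v by (simp add: typical_weight_def)
  define r where "r k = 1 - inverse (real (Suc k))" for k
  define G where "G k = (\<lambda>w. g (of_real (r k) * w))" for k
  define x where "x k n = cmod (samples v z (G k) n - a n)" for k n
  have r: "0 \<le> r k" "r k < 1" for k using radii_bounds[of k] by (simp_all add: r_def)
  have Gball: "G k \<in> growth_ball v C" for k
    unfolding G_def using r[of k] by (intro dilation_in_growth_ball v g) auto
  have Gvan: "vanishing_at_boundary v (G k)" for k
    unfolding G_def by (intro dilation_vanishing_at_boundary v r growth_ballD(1)[OF g])
  have "\<exists>F. finite F \<and> F \<noteq> {} \<and> (\<forall>n. (\<Sum>k\<in>F. x k n) \<le> e * real (card F))"
  proof (rule average_of_null_sequences[where B="2 * C"])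
    show "x k n \<le> 2 * C" for k n
      using norm_triangle_ineq4[of "samples v z (G k) n" "a n"]
        norm_samples_le[OF wv z Gball, of k n] norm_samples_le[OF wv z g, of n]
      by (simp add: x_def a)
    show "x k \<longlonglongrightarrow> 0" for k
    proof -
      have "(\<lambda>n. samples v z (G k) n - a n) \<longlonglongrightarrow> 0 - 0"
        using samples_in_c_zero[OF Gvan z z1] a(2)
        by (intro tendsto_diff) (auto simp: c_zero_def)
      then show ?thesis unfolding x_def using tendsto_norm_zero by fastforce
    qed
    show "(\<lambda>k. x k n) \<longlonglongrightarrow> 0" for n
    proof -
      have "isCont g (z n)"
        using growth_ballD(1)[OF g] z
        by (meson holomorphic_on_imp_continuous_on continuous_on_eq_continuous_at open_ball)
      moreover have "(\<lambda>k. of_real (r k) * z n) \<longlonglongrightarrow> of_real 1 * z n"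
        unfolding r_def by (intro tendsto_mult tendsto_of_real tendsto_const radii_tendsto)
      ultimately have "(\<lambda>k. g (of_real (r k) * z n)) \<longlonglongrightarrow> g (z n)"
        by (intro isCont_tendsto_compose[of "z n" g]) auto
      then have "(\<lambda>k. samples v z (G k) n) \<longlonglongrightarrow> samples v z g n"
        unfolding samples_def G_def by (intro tendsto_intros)
      then show ?thesis unfolding x_def a(1)[symmetric]
        using Lim_null tendsto_norm_zero by fastforce
    qed
  qed (auto simp: x_def \<open>e > 0\<close>)
  then obtain F where F: "finite F" "F \<noteq> {}" "\<And>n. (\<Sum>k\<in>F. x k n) \<le> e * real (card F)" by blast
  define c where "c = card F"
  have c: "c > 0" using F by (simp add: c_def card_gt_0_iff)
  define h where "h = (\<lambda>w. (\<Sum>k\<in>F. G k w) / of_nat c)"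
  show ?thesis
  proof
    have "v w * cmod (h w) \<le> C" if w: "w \<in> unit_disk" for w
    proof -
      have vw: "v w > 0" using wv w by (auto simp: weight_def)
      have "v w * cmod (h w) = v w * cmod (\<Sum>k\<in>F. G k w) / c" by (simp add: h_def norm_divide)
      also have "\<dots> \<le> v w * (\<Sum>k\<in>F. cmod (G k w)) / c"
        using vw by (intro divide_right_mono mult_left_mono norm_sum) auto
      also have "\<dots> = (\<Sum>k\<in>F. v w * cmod (G k w)) / c" by (simp add: sum_distrib_left)
      also have "\<dots> \<le> (\<Sum>k\<in>F. C) / c"
        using growth_ballD(2)[OF Gball w] by (intro divide_right_mono sum_mono) auto
      also have "\<dots> = C" using c by (simp add: c_def)
      finally show ?thesis .
    qed
    moreover have "h holomorphic_on unit_disk"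
      unfolding h_def using c by (intro holomorphic_intros growth_ballD(1)[OF Gball]) auto
    ultimately show "h \<in> growth_ball v C" by (simp add: growth_ball_def)
    have "((\<lambda>w. (\<Sum>k\<in>F. of_real (v w) * G k w) / of_nat c) \<longlongrightarrow> (\<Sum>k\<in>F. 0) / of_nat c) to_boundary"
      using Gvan c by (intro tendsto_intros) (auto simp: vanishing_at_boundary_def)
    then show "vanishing_at_boundary v h"
      by (simp add: vanishing_at_boundary_def h_def sum_distrib_left)
    fix n
    have "samples v z h n - a n = (\<Sum>k\<in>F. samples v z (G k) n - a n) / of_nat c"
      using c by (simp add: samples_def h_def sum_subtractf sum_distrib_left diff_divide_distrib
          c_def[symmetric])
    also have "cmod \<dots> \<le> (\<Sum>k\<in>F. x k n) / c"
      by (simp add: norm_divide x_def divide_right_mono norm_sum)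
    also have "\<dots> \<le> e" using F(3)[of n] c by (simp add: field_simps c_def)
    finally show "cmod (samples v z h n - a n) \<le> e" .
  qed
qed

text \<open>
  The usual iteration of the open mapping theorem: each step halves the residual with a
  correction whose size is proportional to the current residual, so the corrections sum
  geometrically. The limit vanishes at the boundary because the series converges uniformly in
  the weighted norm.
\<close>

lemma vanishing_interpolation_by_successive_approximation:
  assumes v: "weight v" and z: "\<forall>n. z n \<in> unit_disk"
    and z1: "(\<lambda>n. cmod (z n)) \<longlonglongrightarrow> 1" and a: "a \<in> c_zero" and "C > 0"
    and approx: "\<And>b s. b \<in> c_zero \<Longrightarrow> s > 0 \<Longrightarrow> (\<And>n. cmod (b n) \<le> s) \<Longrightarrow>
      \<exists>h\<in>growth_ball v (C * s). vanishing_at_boundary v h \<and>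
        (\<forall>n. cmod (samples v z h n - b n) \<le> s / 2)"
  shows "\<exists>D. \<exists>h\<in>growth_ball v D. vanishing_at_boundary v h \<and> samples v z h = a"
proof -
  have "Bseq a" using a convergentI convergent_imp_Bseq unfolding c_zero_def by blast
  then obtain s where "s > 0" "\<forall>n. cmod (a n) \<le> s" by (rule BseqE)
  then have s: "s > 0" "\<And>n. cmod (a n) \<le> s" by blast+
  \<comment> \<open>\<open>R k\<close> is the residual before step \<open>k\<close> and \<open>h k\<close> the correction made in that step.\<close>
  define pick where "pick k b = (SOME h. h \<in> growth_ball v (C * (s / 2 ^ k)) \<and>
    vanishing_at_boundary v h \<and> (\<forall>n. cmod (samples v z h n - b n) \<le> s / 2 ^ k / 2))" for k b
  define R where "R = rec_nat a (\<lambda>k b. \<lambda>n. b n - samples v z (pick k b) n)"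
  define h where "h k = pick k (R k)" for k
  have R0: "R 0 = a" by (simp add: R_def)
  have RS: "R (Suc k) = (\<lambda>n. R k n - samples v z (h k) n)" for k
    by (simp add: R_def h_def)
  have pick: "pick k b \<in> growth_ball v (C * (s / 2 ^ k)) \<and> vanishing_at_boundary v (pick k b) \<and>
      (\<forall>n. cmod (samples v z (pick k b) n - b n) \<le> s / 2 ^ k / 2)"
    if "b \<in> c_zero" "\<And>n. cmod (b n) \<le> s / 2 ^ k" for k b
  proof -
    have "s / 2 ^ k > 0" using s(1) by simp
    from approx[OF that(1) this that(2)] show ?thesis
      unfolding pick_def Bex_def by (rule someI_ex)
  qed
  have inv: "R k \<in> c_zero \<and> (\<forall>n. cmod (R k n) \<le> s / 2 ^ k)" for k
  proof (induction k)
    case 0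
    then show ?case using a s by (simp add: R0)
  next
    case (Suc k)
    then have p: "vanishing_at_boundary v (h k)" "\<And>n. cmod (samples v z (h k) n - R k n) \<le> s / 2 ^ k / 2"
      using pick[of "R k" k] by (auto simp: h_def)
    have "(\<lambda>n. R k n - samples v z (h k) n) \<longlonglongrightarrow> 0 - 0"
      using Suc samples_in_c_zero[OF p(1) z z1] by (intro tendsto_diff) (auto simp: c_zero_def)
    then show ?case using p(2) by (simp add: RS c_zero_def norm_minus_commute mult.commute)
  qed
  have h: "h k \<in> growth_ball v (C * (s / 2 ^ k))" "vanishing_at_boundary v (h k)" for k
    using pick[of "R k" k] inv[of k] by (auto simp: h_def)
  define M where "M k = C * (s / 2 ^ k)" for k :: nat
  have M: "summable M"
    unfolding M_def using summable_mult[OF summable_geometric[of "1/2::real"], of "C * s"]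
    by (simp add: power_one_over field_simps)
  define H where "H w = (\<Sum>k. h k w)" for w
  have holH: "H holomorphic_on unit_disk"
  proof (rule holomorphic_uniform_sequence)
    show "open unit_disk" by simp
    show "(\<lambda>w. \<Sum>k<n. h k w) holomorphic_on unit_disk" for n
      by (intro holomorphic_intros growth_ballD(1)[OF h(1)])
    fix w assume "w \<in> unit_disk"
    then obtain d where d: "d > 0" "cball w d \<subseteq> unit_disk"
      using open_contains_cball_eq[OF open_ball] by blast
    obtain B where B: "\<And>g w' D. g \<in> growth_ball v D \<Longrightarrow> w' \<in> cball w d \<Longrightarrow> cmod (g w') \<le> B * D"
      by (rule growth_ball_bounded_on_compact[OF v compact_cball d(2)]) (rule that)
    have "uniform_limit (cball w d) (\<lambda>n w. \<Sum>k<n. h k w) H sequentially"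
      unfolding H_def
      by (rule Weierstrass_m_test[where M="\<lambda>k. B * M k"])
        (unfold M_def, rule B[OF h(1)], assumption, rule summable_mult[OF M[unfolded M_def]])
    with d show "\<exists>d>0. cball w d \<subseteq> unit_disk \<and>
        uniform_limit (cball w d) (\<lambda>n w. \<Sum>k<n. h k w) H sequentially" by blast
  qed
  have bound: "norm (of_real (v w) * h k w) \<le> M k" if "w \<in> unit_disk" for k w
    using growth_ballD(2)[OF h(1) that, of k] v that
    by (auto simp: norm_mult M_def weight_def less_imp_le)
  have vH: "of_real (v w) * H w = (\<Sum>k. of_real (v w) * h k w)"
    "summable (\<lambda>k. of_real (v w) * h k w)" if w: "w \<in> unit_disk" for w
  proof -
    show *: "summable (\<lambda>k. of_real (v w) * h k w)"
      by (rule summable_comparison_test'[OF M]) (rule bound[OF w])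
    have "v w \<noteq> 0" using v w unfolding weight_def by force
    then have "summable (\<lambda>k. h k w)" using * by (simp add: summable_cmult_iff)
    then show "of_real (v w) * H w = (\<Sum>k. of_real (v w) * h k w)"
      unfolding H_def by (rule suminf_mult[symmetric])
  qed
  show ?thesis
  proof (intro exI[of _ "suminf M"] bexI[of _ H] conjI)
    have "v w * cmod (H w) \<le> suminf M" if w: "w \<in> unit_disk" for w
    proof -
      have "v w * cmod (H w) = norm (of_real (v w) * H w)"
        using v w by (auto simp: norm_mult weight_def less_imp_le)
      also have "\<dots> \<le> suminf M"
        unfolding vH(1)[OF w] by (rule norm_suminf_le[OF bound[OF w] M])
      finally show ?thesis .
    qed
    then show "H \<in> growth_ball v (suminf M)" using holH by (simp add: growth_ball_def)
    have ul: "uniform_limit unit_disk (\<lambda>n w. \<Sum>k<n. of_real (v w) * h k w)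
        (\<lambda>w. \<Sum>k. of_real (v w) * h k w) sequentially"
      by (rule Weierstrass_m_test[OF bound M])
    have "((\<lambda>w. \<Sum>k. of_real (v w) * h k w) \<longlongrightarrow> 0) to_boundary"
    proof (rule swap_uniform_limit'[OF _ tendsto_const ul eventually_in_disk_to_boundary])
      have "((\<lambda>w. \<Sum>k<n. of_real (v w) * h k w) \<longlongrightarrow> (\<Sum>k<n. 0)) to_boundary" for n
        using h(2) by (intro tendsto_sum) (auto simp: vanishing_at_boundary_def)
      then show "\<forall>\<^sub>F n in sequentially. ((\<lambda>w. \<Sum>k<n. of_real (v w) * h k w) \<longlongrightarrow> 0) to_boundary"
        by simp
    qed simp
    then show "vanishing_at_boundary v H"
      unfolding vanishing_at_boundary_def
      by (rule Lim_transform_eventually)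
        (use eventually_in_disk_to_boundary in eventually_elim, simp add: vH)
    show "samples v z H = a"
    proof
      fix n
      have part: "(\<Sum>k<N. samples v z (h k) n) = a n - R N n" for N
        by (induction N) (auto simp: R0 RS)
      have "(\<lambda>N. R N n) \<longlonglongrightarrow> 0"
      proof (rule Lim_null_comparison)
        show "\<forall>\<^sub>F N in sequentially. norm (R N n) \<le> M N / C"
          using inv \<open>C > 0\<close> by (auto simp: M_def)
        show "(\<lambda>N. M N / C) \<longlonglongrightarrow> 0" by (intro tendsto_divide_zero summable_LIMSEQ_zero M)
      qed
      then have "(\<lambda>N. a n - R N n) \<longlonglongrightarrow> a n - 0" by (intro tendsto_intros)
      then have "(\<lambda>k. samples v z (h k) n) sums a n" by (simp add: sums_def part)
      moreover have "samples v z H n = (\<Sum>k. samples v z (h k) n)"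
        using vH(1) z by (simp add: samples_def)
      ultimately show "samples v z H n = a n" by (simp add: sums_iff)
    qed
  qed
qed

text \<open>
  Interpolating unit vectors separates the points. If infinitely many points lay in a compact
  subset of the disk, a function interpolating the unit vector of index 0 would vanish on an
  infinite subset of that compact set without vanishing identically.
\<close>

lemma interpolation_forces_boundary:
  assumes z: "\<forall>n. z n \<in> unit_disk"
    and interp: "\<And>a. a \<in> c_zero \<Longrightarrow> \<exists>C. \<exists>g\<in>growth_ball v C. samples v z g = a"
  shows "(\<lambda>n. cmod (z n)) \<longlonglongrightarrow> 1"
proof (rule ccontr)
  assume "\<not> ?thesis"
  then obtain e where e: "e > 0" "\<not> (\<forall>\<^sub>F n in sequentially. dist (cmod (z n)) 1 < e)"
    by (auto simp: tendsto_iff)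
  define I where "I = {n. cmod (z n) \<le> 1 - e}"
  have "infinite I"
  proof
    assume "finite I"
    then have "\<forall>\<^sub>F n in sequentially. n \<notin> I"
      by (metis Max.coboundedI eventually_at_top_dense not_le)
    then have "\<forall>\<^sub>F n in sequentially. dist (cmod (z n)) 1 < e"
      by eventually_elim (use z in \<open>auto simp: I_def dist_real_def abs_if\<close>)
    with e show False by simp
  qed
  have unit: "\<exists>g. g holomorphic_on unit_disk \<and> g (z m) \<noteq> 0 \<and> (\<forall>n. n \<noteq> m \<longrightarrow> v (z n) = 0 \<or> g (z n) = 0)
      \<and> v (z m) \<noteq> 0" for m
  proof -
    have "(\<lambda>n. if n = m then 1 else 0) \<in> c_zero"
      unfolding c_zero_def mem_Collect_eq
      by (rule tendsto_eventually) (auto simp: eventually_sequentially intro: exI[of _ "Suc m"])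
    then obtain C g where g: "g \<in> growth_ball v C" "samples v z g = (\<lambda>n. if n = m then 1 else 0)"
      using interp by blast
    then have "of_real (v (z n)) * g (z n) = (if n = m then 1 else 0)" for n
      by (metis samples_def)
    then show ?thesis using growth_ballD(1)[OF g(1)]
      by (metis mult_eq_0_iff of_real_eq_0_iff zero_neq_one)
  qed
  have v0: "v (z n) \<noteq> 0" for n using unit by blast
  have "inj z"
    using unit v0 by (metis injI)
  obtain g where g: "g holomorphic_on unit_disk" "g (z 0) \<noteq> 0" "\<And>n. n \<noteq> 0 \<Longrightarrow> g (z n) = 0"
    using unit[of 0] v0 by blast
  have "\<not> g constant_on unit_disk"
    using g(2) g(3)[of 1] z unfolding constant_on_def by (metis one_neq_zero)
  then have "finite {w \<in> cball 0 (1 - e). g w = 0}"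
    using e(1) by (intro holomorphic_compact_finite_zeros[OF g(1)]) auto
  moreover have "z ` (I - {0}) \<subseteq> {w \<in> cball 0 (1 - e). g w = 0}"
    using g(3) by (auto simp: I_def)
  ultimately have "finite (z ` (I - {0}))" by (rule finite_subset[rotated])
  then have "finite (I - {0})"
    using \<open>inj z\<close> by (metis finite_imageD inj_on_subset subset_UNIV)
  then show False using \<open>infinite I\<close> by simp
qed

section \<open>The two interpolation properties are equivalent\<close>

lemma deriv_of_bloch:
  assumes "f \<in> bloch_inf v"
  obtains C where "deriv f \<in> growth_ball v C"
proof -
  obtain C where "\<And>w. w \<in> unit_disk \<Longrightarrow> v w * cmod (deriv f w) \<le> C"
    using assms unfolding bloch_inf_def bdd_above_def by blast
  moreover have "deriv f holomorphic_on unit_disk"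
    using assms by (intro holomorphic_deriv) (auto simp: bloch_inf_def hol_disk_def)
  ultimately show ?thesis using that[of C] by (simp add: growth_ball_def)
qed

lemma bloch_zero_iff:
  assumes "weight v"
  shows "f \<in> bloch_zero v \<longleftrightarrow> f \<in> bloch_inf v \<and> vanishing_at_boundary v (deriv f)"
  using vanishing_at_boundary_iff_norm[OF assms] by (simp add: bloch_zero_def)

text \<open>
  A primitive exists because the disk is convex; it is made 0 off the disk to be an element of
  the carrier.
\<close>

lemma bloch_primitive:
  assumes "g \<in> growth_ball v C"
  obtains f where "f \<in> bloch_inf v" "\<And>w. w \<in> unit_disk \<Longrightarrow> deriv f w = g w"
proof -
  obtain F where F: "\<And>x. x \<in> unit_disk \<Longrightarrow> (F has_field_derivative g x) (at x within unit_disk)"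
    using holomorphic_convex_primitive'[of unit_disk g] growth_ballD(1)[OF assms] by auto
  define f where "f w = (if w \<in> unit_disk then F w else 0)" for w
  have f: "(f has_field_derivative g w) (at w)" if w: "w \<in> unit_disk" for w
  proof (rule has_field_derivative_transform_within_open[OF _ open_ball w])
    show "(F has_field_derivative g w) (at w)"
      using F[OF w] w by (simp add: at_within_open[OF w])
  qed (simp add: f_def)
  show ?thesis
  proof
    show d: "deriv f w = g w" if "w \<in> unit_disk" for w
      using f[OF that] by (rule DERIV_imp_deriv)
    have "f holomorphic_on unit_disk"
      using f by (meson has_field_derivative_at_within holomorphic_onI field_differentiable_def)
    then show "f \<in> bloch_inf v"
      using growth_ballD(2)[OF assms]
      by (auto simp: bloch_inf_def hol_disk_def f_def d intro!: bdd_aboveI2[of _ _ C])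
  qed
qed

text \<open>
  Interpolating \<open>c\<^sub>0\<close> data by functions that are merely bounded in the weighted norm is enough
  to obtain interpolants that vanish at the boundary, and also (the next lemma) interpolants
  for all bounded data. Both interpolation properties imply this common hypothesis, which is
  why they are equivalent.
\<close>

lemma c0_growth_interpolation_imp_vanishing:
  assumes v: "typical_weight v" and z: "\<forall>n. z n \<in> unit_disk"
    and growth: "\<And>a. a \<in> c_zero \<Longrightarrow> \<exists>C. \<exists>g\<in>growth_ball v C. samples v z g = a"
    and a: "a \<in> c_zero"
  shows "\<exists>D. \<exists>h\<in>growth_ball v D. vanishing_at_boundary v h \<and> samples v z h = a"
proof -
  have wv: "weight v" using v by (simp add: typical_weight_def)
  have z1: "(\<lambda>n. cmod (z n)) \<longlonglongrightarrow> 1"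
    by (rule interpolation_forces_boundary[OF z growth])
  show ?thesis
  proof (rule uniform_interpolation_constant[OF wv z growth])
    fix C :: real
    assume C: "C > 0" "\<And>a s. s \<ge> 0 \<Longrightarrow> (\<And>n. cmod (a n) \<le> s) \<Longrightarrow>
      \<exists>g\<in>growth_ball v (C * s). samples v z g = a"
    show ?thesis
    proof (rule vanishing_interpolation_by_successive_approximation[OF wv z z1 a C(1)])
      fix b s assume b: "b \<in> c_zero" "(s::real) > 0" "\<And>n. cmod (b n) \<le> s"
      have "\<exists>g\<in>growth_ball v (C * s). samples v z g = b"
        using b(2) by (intro C(2) b(3)) simp
      then obtain g where g: "g \<in> growth_ball v (C * s)" "samples v z g = b" by blast
      show "\<exists>h\<in>growth_ball v (C * s). vanishing_at_boundary v h \<and>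
          (\<forall>n. cmod (samples v z h n - b n) \<le> s / 2)"
        by (rule vanishing_approximate_interpolation[OF v z z1 g b(1), of "s/2"])
          (use b(2) in auto)
    qed
  qed
qed

lemma c0_growth_interpolation_imp_bounded:
  assumes wv: "weight v" and z: "\<forall>n. z n \<in> unit_disk"
    and growth: "\<And>a. a \<in> c_zero \<Longrightarrow> \<exists>C. \<exists>g\<in>growth_ball v C. samples v z g = a"
    and a: "a \<in> ell_inf"
  shows "\<exists>D. \<exists>h\<in>growth_ball v D. samples v z h = a"
proof (rule uniform_interpolation_constant[OF wv z growth])
  fix C :: real
  assume C: "\<And>a s. s \<ge> 0 \<Longrightarrow> (\<And>n. cmod (a n) \<le> s) \<Longrightarrow>
    \<exists>g\<in>growth_ball v (C * s). samples v z g = a"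
  obtain s where s: "\<And>n. cmod (a n) \<le> s"
    using a unfolding ell_inf_def bounded_iff by blast
  have "s \<ge> 0" using order_trans[OF norm_ge_zero s] .
  then have "\<exists>g\<in>growth_ball v (C * s). samples v z g = a" by (intro C s)
  then show ?thesis by blast
qed

lemma bloch_samples_bounded:
  assumes "f \<in> bloch_inf v"
  shows "\<exists>C. \<exists>g\<in>growth_ball v C. samples v z g = (\<lambda>n. of_real (v (z n)) * deriv f (z n))"
  by (rule deriv_of_bloch[OF assms]) (auto simp: samples_def)

theorem interpolating_iff_c0_interpolating:
  assumes v: "typical_weight v" and z: "\<forall>n. z n \<in> unit_disk"
  shows "interpolating v z \<longleftrightarrow> c0_interpolating v z"
proof
  have wv: "weight v" using v by (simp add: typical_weight_def)
  show "c0_interpolating v z" if int: "interpolating v z"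
    unfolding c0_interpolating_def
  proof
    fix a assume a: "a \<in> c_zero"
    have growth: "\<exists>C. \<exists>g\<in>growth_ball v C. samples v z g = b" if "b \<in> c_zero" for b
    proof -
      have "b \<in> ell_inf"
        using that convergent_imp_bounded unfolding c_zero_def ell_inf_def by blast
      then obtain f where f: "f \<in> bloch_inf v" "\<forall>n. of_real (v (z n)) * deriv f (z n) = b n"
        using int unfolding interpolating_def by blast
      show ?thesis using bloch_samples_bounded[OF f(1), of z] f(2) by simp
    qed
    from c0_growth_interpolation_imp_vanishing[OF v z growth a]
    obtain D h where h: "h \<in> growth_ball v D" "vanishing_at_boundary v h" "samples v z h = a"
      by blast
    from h(1) show "\<exists>f\<in>bloch_zero v. \<forall>n. of_real (v (z n)) * deriv f (z n) = a n"
    proof (rule bloch_primitive)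
      fix f assume f: "f \<in> bloch_inf v" "\<And>w. w \<in> unit_disk \<Longrightarrow> deriv f w = h w"
      have "vanishing_at_boundary v (deriv f)"
        using h(2) unfolding vanishing_at_boundary_def
        by (rule Lim_transform_eventually)
          (use eventually_in_disk_to_boundary in eventually_elim, simp add: f)
      then have "f \<in> bloch_zero v" using f(1) bloch_zero_iff[OF wv] by blast
      moreover have "\<forall>n. of_real (v (z n)) * deriv f (z n) = a n"
        using f(2) z unfolding h(3)[symmetric] samples_def by simp
      ultimately show ?thesis by blast
    qed
  qed
  show "interpolating v z" if c0: "c0_interpolating v z"
    unfolding interpolating_def
  proof
    fix a assume a: "a \<in> ell_inf"
    have growth: "\<exists>C. \<exists>g\<in>growth_ball v C. samples v z g = b" if "b \<in> c_zero" for b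
    proof -
      from bspec[OF c0[unfolded c0_interpolating_def] that]
      obtain f where f: "f \<in> bloch_zero v" "\<forall>n. of_real (v (z n)) * deriv f (z n) = b n" ..
      from f(1) have "f \<in> bloch_inf v" by (simp add: bloch_zero_def)
      from bloch_samples_bounded[OF this, of z] f(2) show ?thesis by simp
    qed
    from c0_growth_interpolation_imp_bounded[OF wv z growth a]
    obtain D h where h: "h \<in> growth_ball v D" "samples v z h = a" by blast
    from h(1) show "\<exists>f\<in>bloch_inf v. \<forall>n. of_real (v (z n)) * deriv f (z n) = a n"
    proof (rule bloch_primitive)
      fix f assume f: "f \<in> bloch_inf v" "\<And>w. w \<in> unit_disk \<Longrightarrow> deriv f w = h w"
      have "\<forall>n. of_real (v (z n)) * deriv f (z n) = a n"
        using f(2) z unfolding h(2)[symmetric] samples_def by simp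
      then show ?thesis using f(1) by blast
    qed
  qed
qed

lemma c_zero_subset_ell_inf: "c_zero \<subseteq> ell_inf"
  unfolding c_zero_def ell_inf_def using convergent_imp_bounded by blast

section \<open>The dual of the null sequences\<close>

lemma norm_le_sup_norm:
  assumes "a \<in> ell_inf"
  shows "cmod (a n) \<le> sup_norm a"
proof -
  obtain s where "\<And>n. cmod (a n) \<le> s"
    using assms unfolding ell_inf_def bounded_iff by blast
  then have "bdd_above (range (\<lambda>n. cmod (a n)))" by (intro bdd_aboveI2)
  then show ?thesis unfolding sup_norm_def by (intro cSUP_upper) auto
qed

lemma sup_norm_le: "(\<And>n. cmod (a n) \<le> s) \<Longrightarrow> sup_norm a \<le> s"
  unfolding sup_norm_def by (intro cSUP_least) auto

lemma summable_seq_pairing: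
  assumes "b \<in> ell_one" "\<And>n. cmod (a n) \<le> s"
  shows "summable (\<lambda>n. b n * a n)"
proof (rule summable_comparison_test')
  show "summable (\<lambda>n. cmod (b n) * s)" using assms(1) by (simp add: ell_one_def summable_mult2)
  show "norm (b n * a n) \<le> cmod (b n) * s" for n
    unfolding norm_mult by (intro mult_left_mono assms) auto
qed

lemma norm_seq_pairing_le:
  assumes "b \<in> ell_one" "\<And>n. cmod (a n) \<le> s"
  shows "cmod (\<Sum>n. b n * a n) \<le> (\<Sum>n. cmod (b n)) * s"
proof -
  have s: "summable (\<lambda>n. cmod (b n))" using assms(1) by (simp add: ell_one_def)
  have "cmod (\<Sum>n. b n * a n) \<le> (\<Sum>n. cmod (b n) * s)"
  proof (rule norm_suminf_le)
    show "norm (b n * a n) \<le> cmod (b n) * s" for n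
      unfolding norm_mult by (intro mult_left_mono assms) auto
  qed (intro summable_mult2 s)
  then show ?thesis using suminf_mult2[OF s, of s] by simp
qed

text \<open>
  Classical: the coefficients are the values at the unit vectors. Testing on truncations of
  the conjugate signs of the coefficients bounds the partial sums of their absolute values,
  and density of the finitely supported sequences identifies the functional.
\<close>

lemma dual_of_c_zero_is_ell_one:
  assumes "\<phi> \<in> dual_space c_zero sup_norm"
  shows "\<phi> \<in> restrict_functional seq_pairing c_zero ` ell_one"
proof -
  define e :: "nat \<Rightarrow> nat \<Rightarrow> complex" where "e k = (\<lambda>n. if n = k then 1 else 0)" for k
  define b where "b k = \<phi> (e k)" for k
  define tr :: "nat \<Rightarrow> (nat \<Rightarrow> complex) \<Rightarrow> nat \<Rightarrow> complex"
    where "tr N a = (\<lambda>n. if n < N then a n else 0)" for N a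
  have add: "\<phi> (\<lambda>n. x n + y n) = \<phi> x + \<phi> y" if "x \<in> c_zero" "y \<in> c_zero" for x y
    using assms that unfolding dual_space_def by blast
  have mult: "\<phi> (\<lambda>n. c * x n) = c * \<phi> x" if "x \<in> c_zero" for x c
    using assms that unfolding dual_space_def by blast
  obtain C where C: "\<And>x. x \<in> c_zero \<Longrightarrow> cmod (\<phi> x) \<le> C * sup_norm x"
    using assms unfolding dual_space_def by blast
  have off: "\<phi> x = 0" if "x \<notin> c_zero" for x
    using assms that unfolding dual_space_def by blast
  have ec: "e k \<in> c_zero" for k
    unfolding c_zero_def mem_Collect_eq e_def
    by (rule tendsto_eventually) (auto simp: eventually_sequentially intro: exI[of _ "Suc k"])
  have trc: "tr N a \<in> c_zero" for N a
    unfolding tr_def by (rule truncation_in_c_zero)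
  have cmultc: "(\<lambda>n. c * x n) \<in> c_zero" if "x \<in> c_zero" for c x
    using that by (simp add: c_zero_def tendsto_mult_right_zero)
  have \<phi>tr: "\<phi> (tr N a) = (\<Sum>n<N. b n * a n)" for N a
  proof (induction N)
    case 0
    have "tr 0 a = (\<lambda>n. 0 * e 0 n)" by (simp add: tr_def)
    then show ?case using mult[OF ec, of 0 0] by simp
  next
    case (Suc N)
    have "tr (Suc N) a = (\<lambda>n. tr N a n + a N * e N n)"
      by (auto simp: tr_def e_def fun_eq_iff less_Suc_eq)
    then show ?case
      using Suc add[OF trc cmultc[OF ec]] mult[OF ec] by (simp add: b_def mult.commute)
  qed
  have "b \<in> ell_one"
    unfolding ell_one_def mem_Collect_eq
  proof (rule bounded_imp_summable)
    fix N
    define a where "a n = cnj (sgn (b n))" for n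
    have "(\<Sum>n<Suc N. b n * a n) = of_real (\<Sum>n<Suc N. cmod (b n))"
      unfolding of_real_sum
    proof (rule sum.cong[OF refl])
      fix n
      have "b n * a n = (b n * cnj (b n)) / of_real (cmod (b n))"
        by (simp add: a_def sgn_div_norm scaleR_conv_of_real divide_inverse)
      then show "b n * a n = of_real (cmod (b n))"
        by (simp add: complex_norm_square[symmetric] power2_eq_square)
    qed
    then have "(\<Sum>n<Suc N. cmod (b n)) = cmod (\<phi> (tr (Suc N) a))"
      by (metis \<phi>tr abs_of_nonneg norm_ge_zero norm_of_real sum_nonneg)
    also have "\<dots> \<le> C * sup_norm (tr (Suc N) a)" by (rule C[OF trc])
    also have "\<dots> \<le> \<bar>C\<bar> * 1"
    proof (rule mult_mono)
      show "sup_norm (tr (Suc N) a) \<le> 1"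
        by (rule sup_norm_le) (auto simp: tr_def a_def norm_sgn)
      show "0 \<le> sup_norm (tr (Suc N) a)"
        using norm_le_sup_norm[of "tr (Suc N) a" 0] trc c_zero_subset_ell_inf
        by (meson norm_ge_zero order_trans subsetD)
    qed auto
    finally show "(\<Sum>n\<le>N. cmod (b n)) \<le> \<bar>C\<bar>" by (simp add: lessThan_Suc_atMost)
  qed auto
  have "\<phi> a = seq_pairing b a" if a: "a \<in> c_zero" for a
  proof -
    have "(\<lambda>N. \<phi> (tr N a)) \<longlonglongrightarrow> \<phi> a"
    proof (rule metric_LIMSEQ_I)
      fix r :: real assume "r > 0"
      define d where "d = r / (\<bar>C\<bar> + 1)"
      have "d > 0" using \<open>r > 0\<close> by (simp add: d_def)
      then obtain N where N: "\<And>n. n \<ge> N \<Longrightarrow> cmod (a n) < d"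
        using a unfolding c_zero_def by (metis LIMSEQ_D diff_zero mem_Collect_eq)
      have "dist (\<phi> (tr M a)) (\<phi> a) < r" if "M \<ge> N" for M
      proof -
        define y where "y = (\<lambda>n. a n + (-1) * tr M a n)"
        have "y \<longlonglongrightarrow> 0 + 0"
          unfolding y_def using a cmultc[OF trc] unfolding c_zero_def mem_Collect_eq
          by (rule tendsto_add)
        then have y: "y \<in> c_zero" by (simp add: c_zero_def)
        have "\<phi> y = \<phi> a - \<phi> (tr M a)"
          using add[OF a cmultc[OF trc], of "-1" M a] mult[OF trc, of "-1" M a]
          by (simp add: y_def)
        then have "dist (\<phi> (tr M a)) (\<phi> a) = cmod (\<phi> y)"
          by (simp add: dist_norm norm_minus_commute)
        also have "\<dots> \<le> C * sup_norm y" by (rule C[OF y])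
        also have "\<dots> \<le> \<bar>C\<bar> * d"
        proof (rule mult_mono)
          show "sup_norm y \<le> d"
            using N \<open>d > 0\<close> that
            by (intro sup_norm_le) (auto simp: y_def tr_def intro: less_imp_le)
          show "0 \<le> sup_norm y"
            using norm_le_sup_norm[of y 0] y c_zero_subset_ell_inf
            by (meson norm_ge_zero order_trans subsetD)
        qed auto
        also have "\<dots> < (\<bar>C\<bar> + 1) * d" using \<open>d > 0\<close> by simp
        also have "\<dots> = r" by (simp add: d_def)
        finally show ?thesis .
      qed
      then show "\<exists>N. \<forall>M\<ge>N. dist (\<phi> (tr M a)) (\<phi> a) < r" by blast
    qed
    then have "(\<lambda>n. b n * a n) sums \<phi> a" by (simp add: \<phi>tr sums_def)
    then show ?thesis by (simp add: seq_pairing_def sums_iff)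
  qed
  then have "\<phi> = restrict_functional seq_pairing c_zero b"
    using off by (auto simp: restrict_functional_def fun_eq_iff)
  then show ?thesis using \<open>b \<in> ell_one\<close> by blast
qed

section \<open>Bloch type spaces\<close>

lemma bloch_infI:
  assumes "f \<in> hol_disk" "\<And>w. w \<in> unit_disk \<Longrightarrow> deriv f w = g w" "g \<in> growth_ball v C"
  shows "f \<in> bloch_inf v"
  using assms growth_ballD(2)[OF assms(3)] by (auto simp: bloch_inf_def intro!: bdd_aboveI2[of _ _ C])

lemma bloch_norm_le:
  assumes "\<And>w. w \<in> unit_disk \<Longrightarrow> deriv f w = g w" "g \<in> growth_ball v C"
  shows "bloch_norm v f \<le> cmod (f 0) + C"
  unfolding bloch_norm_def using assms growth_ballD(2)[OF assms(2)]
  by (intro add_left_mono cSUP_least) auto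

lemma deriv_bloch_in_growth_ball:
  assumes "f \<in> bloch_inf v"
  shows "deriv f \<in> growth_ball v (bloch_norm v f - cmod (f 0))"
proof -
  have "v w * cmod (deriv f w) \<le> (SUP z\<in>unit_disk. v z * cmod (deriv f z))"
    if "w \<in> unit_disk" for w
    using assms that by (intro cSUP_upper) (auto simp: bloch_inf_def)
  moreover have "deriv f holomorphic_on unit_disk"
    using assms by (intro holomorphic_deriv) (auto simp: bloch_inf_def hol_disk_def)
  ultimately show ?thesis by (simp add: growth_ball_def bloch_norm_def)
qed

lemma norm_interp_op_le:
  assumes "weight v" "\<forall>n. z n \<in> unit_disk" "f \<in> bloch_inf v"
  shows "cmod (interp_op v z f n) \<le> bloch_norm v f"
  using norm_samples_le[OF assms(1,2) deriv_bloch_in_growth_ball[OF assms(3)], of n]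
    norm_ge_zero[of "f 0"]
  unfolding samples_def interp_op_def by linarith

lemma hol_disk_differentiable:
  assumes "f \<in> hol_disk" "w \<in> unit_disk"
  shows "f field_differentiable at w"
  using assms by (auto simp: hol_disk_def intro: holomorphic_on_imp_differentiable_at)

lemma bloch_inf_add:
  assumes v: "weight v" and f: "f \<in> bloch_inf v" and g: "g \<in> bloch_inf v"
  shows "(\<lambda>x. f x + g x) \<in> bloch_inf v"
    and "w \<in> unit_disk \<Longrightarrow> deriv (\<lambda>x. f x + g x) w = deriv f w + deriv g w"
proof -
  have fg: "f \<in> hol_disk" "g \<in> hol_disk" using f g by (auto simp: bloch_inf_def)
  show d: "deriv (\<lambda>x. f x + g x) w = deriv f w + deriv g w" if "w \<in> unit_disk" for w
    using hol_disk_differentiable[OF fg(1) that] hol_disk_differentiable[OF fg(2) that] by simp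
  obtain C where C: "deriv f \<in> growth_ball v C" by (rule deriv_of_bloch[OF f])
  obtain D where D: "deriv g \<in> growth_ball v D" by (rule deriv_of_bloch[OF g])
  show "(\<lambda>x. f x + g x) \<in> bloch_inf v"
  proof (rule bloch_infI[OF _ d])
    show "(\<lambda>x. f x + g x) \<in> hol_disk"
      using fg by (auto simp: hol_disk_def intro!: holomorphic_intros)
    have "v w * cmod (deriv f w + deriv g w) \<le> C + D" if w: "w \<in> unit_disk" for w
    proof -
      have "0 < v w" using v w unfolding weight_def by blast
      then have "v w * cmod (deriv f w + deriv g w) \<le> v w * (cmod (deriv f w) + cmod (deriv g w))"
        by (intro mult_left_mono norm_triangle_ineq) auto
      then show ?thesis
        using growth_ballD(2)[OF C w] growth_ballD(2)[OF D w] by (simp add: distrib_left)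
    qed
    then show "(\<lambda>w. deriv f w + deriv g w) \<in> growth_ball v (C + D)"
      using growth_ballD(1)[OF C] growth_ballD(1)[OF D]
      by (auto simp: growth_ball_def intro!: holomorphic_intros)
  qed
qed

lemma growth_ball_cmult:
  assumes "g \<in> growth_ball v C"
  shows "(\<lambda>w. c * g w) \<in> growth_ball v (cmod c * C)"
proof -
  have "v w * cmod (c * g w) \<le> cmod c * C" if "w \<in> unit_disk" for w
    using mult_left_mono[OF growth_ballD(2)[OF assms that], of "cmod c"]
    by (simp add: norm_mult mult_ac)
  then show ?thesis
    using growth_ballD(1)[OF assms] by (auto simp: growth_ball_def intro!: holomorphic_intros)
qed

lemma bloch_inf_cmult:
  assumes f: "f \<in> bloch_inf v"
  shows "(\<lambda>x. c * f x) \<in> bloch_inf v"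
    and "w \<in> unit_disk \<Longrightarrow> deriv (\<lambda>x. c * f x) w = c * deriv f w"
    and "bloch_norm v (\<lambda>x. c * f x) \<le> cmod c * bloch_norm v f"
proof -
  have fh: "f \<in> hol_disk" using f by (auto simp: bloch_inf_def)
  show d: "deriv (\<lambda>x. c * f x) w = c * deriv f w" if "w \<in> unit_disk" for w
    using hol_disk_differentiable[OF fh that] by (rule deriv_cmult)
  note gb = growth_ball_cmult[OF deriv_bloch_in_growth_ball[OF f], of c]
  have "(\<lambda>x. c * f x) \<in> hol_disk"
    using fh by (auto simp: hol_disk_def intro!: holomorphic_intros)
  then show "(\<lambda>x. c * f x) \<in> bloch_inf v" by (rule bloch_infI[OF _ d gb])
  show "bloch_norm v (\<lambda>x. c * f x) \<le> cmod c * bloch_norm v f"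
    using bloch_norm_le[OF d gb] by (simp add: norm_mult right_diff_distrib)
qed

lemma bloch_zero_add:
  assumes v: "weight v" and f: "f \<in> bloch_zero v" and g: "g \<in> bloch_zero v"
  shows "(\<lambda>x. f x + g x) \<in> bloch_zero v"
proof -
  have fg: "f \<in> bloch_inf v" "g \<in> bloch_inf v"
    "vanishing_at_boundary v (deriv f)" "vanishing_at_boundary v (deriv g)"
    using f g bloch_zero_iff[OF v] by auto
  have "((\<lambda>w. of_real (v w) * deriv f w + of_real (v w) * deriv g w) \<longlongrightarrow> 0 + 0) to_boundary"
    using fg(3,4) unfolding vanishing_at_boundary_def by (rule tendsto_add)
  then have "vanishing_at_boundary v (deriv (\<lambda>x. f x + g x))"
    unfolding vanishing_at_boundary_def add_0
    by (rule Lim_transform_eventually)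
      (use eventually_in_disk_to_boundary in eventually_elim,
        simp add: bloch_inf_add(2)[OF v fg(1,2)] distrib_left)
  then show ?thesis using bloch_inf_add(1)[OF v fg(1,2)] bloch_zero_iff[OF v] by blast
qed

lemma bloch_zero_cmult:
  assumes v: "weight v" and f: "f \<in> bloch_zero v"
  shows "(\<lambda>x. c * f x) \<in> bloch_zero v"
proof -
  have ff: "f \<in> bloch_inf v" "vanishing_at_boundary v (deriv f)"
    using f bloch_zero_iff[OF v] by auto
  have "((\<lambda>w. c * (of_real (v w) * deriv f w)) \<longlongrightarrow> 0) to_boundary"
    using ff(2) unfolding vanishing_at_boundary_def by (rule tendsto_mult_right_zero)
  then have "vanishing_at_boundary v (deriv (\<lambda>x. c * f x))"
    unfolding vanishing_at_boundary_def
    by (rule Lim_transform_eventually)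
      (use eventually_in_disk_to_boundary in eventually_elim,
        simp add: bloch_inf_cmult(2)[OF ff(1)])
  then show ?thesis using bloch_inf_cmult(1)[OF ff(1)] bloch_zero_iff[OF v] by blast
qed

lemma interp_op_bloch_zero:
  assumes "weight v" "\<forall>n. z n \<in> unit_disk" "(\<lambda>n. cmod (z n)) \<longlonglongrightarrow> 1" "f \<in> bloch_zero v"
  shows "interp_op v z f \<in> c_zero"
  using samples_in_c_zero[OF _ assms(2,3), of v "deriv f"] assms(4)
  unfolding bloch_zero_iff[OF assms(1)] samples_def interp_op_def by blast

lemma interp_op_bloch_inf:
  assumes "weight v" "\<forall>n. z n \<in> unit_disk" "f \<in> bloch_inf v"
  shows "interp_op v z f \<in> ell_inf"
  unfolding ell_inf_def mem_Collect_eq bounded_iff using norm_interp_op_le[OF assms] by blast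

section \<open>Sampling functionals belong to the predual\<close>

text \<open>
  The adjoint of the interpolating operator at the element \<open>b\<close> of \<open>\<ell>\<^sub>1\<close>, as a functional with
  domain \<open>V\<close>. It is needed for two domains: the functions of the large space with value 0 at
  0, for the predual, and the small space, for its dual.
\<close>

definition sample_functional ::
  "(complex \<Rightarrow> real) \<Rightarrow> (nat \<Rightarrow> complex) \<Rightarrow> (nat \<Rightarrow> complex) \<Rightarrow> (complex \<Rightarrow> complex) set \<Rightarrow>
   (complex \<Rightarrow> complex) \<Rightarrow> complex" where
  "sample_functional v z b V f = (if f \<in> V then seq_pairing b (interp_op v z f) else 0)"

lemma sample_functional_in_dual_space:
  assumes v: "weight v" and z: "\<forall>n. z n \<in> unit_disk" and b: "b \<in> ell_one"
    and V: "V \<subseteq> bloch_inf v" and Vadd: "\<And>f g. f \<in> V \<Longrightarrow> g \<in> V \<Longrightarrow> (\<lambda>x. f x + g x) \<in> V"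
    and Vmult: "\<And>c f. f \<in> V \<Longrightarrow> (\<lambda>x. c * f x) \<in> V"
  shows "sample_functional v z b V \<in> dual_space V (bloch_norm v)"
  unfolding dual_space_def mem_Collect_eq
proof (intro conjI ballI allI exI impI)
  note sm = summable_seq_pairing[OF b norm_interp_op_le[OF v z]]
  show "sample_functional v z b V (\<lambda>x. f x + g x) =
      sample_functional v z b V f + sample_functional v z b V g" if "f \<in> V" "g \<in> V" for f g
  proof -
    have fg: "f \<in> bloch_inf v" "g \<in> bloch_inf v" using that V by auto
    have "interp_op v z (\<lambda>x. f x + g x) = (\<lambda>n. interp_op v z f n + interp_op v z g n)"
      using z bloch_inf_add(2)[OF v fg] by (simp add: interp_op_def distrib_left)
    then show ?thesis
      using that Vadd suminf_add[OF sm[OF fg(1)] sm[OF fg(2)]]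
      by (simp add: sample_functional_def seq_pairing_def distrib_left)
  qed
  show "sample_functional v z b V (\<lambda>x. c * f x) = c * sample_functional v z b V f"
    if "f \<in> V" for c f
  proof -
    have f: "f \<in> bloch_inf v" using that V by auto
    have "interp_op v z (\<lambda>x. c * f x) = (\<lambda>n. c * interp_op v z f n)"
      using z bloch_inf_cmult(2)[OF f] by (simp add: interp_op_def mult.left_commute)
    then show ?thesis
      using that Vmult suminf_mult[OF sm[OF f], of c]
      by (simp add: sample_functional_def seq_pairing_def mult.left_commute)
  qed
  show "cmod (sample_functional v z b V f) \<le> (\<Sum>n. cmod (b n)) * bloch_norm v f" if "f \<in> V" for f
    using norm_seq_pairing_le[OF b norm_interp_op_le[OF v z]] that V
    by (auto simp: sample_functional_def seq_pairing_def)
qed (simp add: sample_functional_def)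

lemma continuous_map_cmult:
  fixes f :: "'a \<Rightarrow> complex"
  assumes "continuous_map X euclidean f"
  shows "continuous_map X euclidean (\<lambda>x. c * f x)"
proof -
  have "continuous_map euclidean euclidean ((*) c)"
    by (simp add: continuous_map_iff_continuous2 continuous_intros)
  from continuous_map_compose[OF assms this] show ?thesis by (simp add: o_def)
qed

lemma evaluation_continuous_compact_open:
  assumes "w \<in> unit_disk" "B \<subseteq> hol_disk"
  shows "continuous_map (subtopology compact_open_topology B) euclidean (\<lambda>f. f w)"
  unfolding continuous_map_def
proof (intro conjI allI impI)
  fix U :: "complex set" assume "openin euclidean U"
  then have "open U" by simp
  have "openin compact_open_topology {f \<in> hol_disk. f ` {w} \<subseteq> U}"
    unfolding compact_open_topology_def
  proof (rule topology_generated_by_Basis, intro CollectI exI conjI)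
    show "compact {w}" "{w} \<subseteq> unit_disk" "open U"
      using assms(1) \<open>open U\<close> by auto
  qed (rule refl)
  moreover have "{f \<in> topspace (subtopology compact_open_topology B). f w \<in> U} =
      {f \<in> hol_disk. f ` {w} \<subseteq> U} \<inter> B"
    using openin_subset[OF calculation] assms(2) by auto
  ultimately show "openin (subtopology compact_open_topology B)
      {f \<in> topspace (subtopology compact_open_topology B). f w \<in> U}"
    by (auto simp: openin_subtopology)
qed auto

text \<open>
  Cauchy's estimate bounds \<open>f''\<close> near \<open>w\<close> uniformly over the growth ball, so Taylor's formula
  makes the difference quotients converge uniformly over the ball.
\<close>

lemma difference_quotient_error:
  assumes v: "weight v" and w: "w \<in> unit_disk"
  obtains r M where "r > 0" "cball w r \<subseteq> unit_disk"
    "\<And>f h. f \<in> hol_disk \<Longrightarrow> deriv f \<in> growth_ball v 1 \<Longrightarrow> h \<noteq> 0 \<Longrightarrow> cmod h \<le> r \<Longrightarrow>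
       cmod ((f (w + h) - f w) / h - deriv f w) \<le> M * cmod h"
proof -
  obtain e where e: "e > 0" "cball w e \<subseteq> unit_disk"
    using w open_contains_cball_eq[OF open_ball] by blast
  define r where "r = e / 2"
  have r: "r > 0" "cball w r \<subseteq> unit_disk" using e by (auto simp: r_def)
  have sub: "cball x r \<subseteq> cball w e" if "x \<in> cball w r" for x
    using that unfolding r_def subset_iff mem_cball by (metis dist_triangle_half_l dist_commute
      dist_triangle field_sum_of_halves add_mono order_trans)
  show ?thesis
  proof (rule growth_ball_bounded_on_compact[OF v compact_cball e(2)])
    fix B assume B: "\<And>g x C. g \<in> growth_ball v C \<Longrightarrow> x \<in> cball w e \<Longrightarrow> cmod (g x) \<le> B * C"
    show ?thesis
    proof (rule that[OF r, of "B / r"])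
      fix f h assume f: "f \<in> hol_disk" "deriv f \<in> growth_ball v 1" and h: "h \<noteq> 0" "cmod h \<le> r"
      have hf: "f holomorphic_on unit_disk" using f(1) by (simp add: hol_disk_def)
      have hf': "deriv f holomorphic_on unit_disk" by (rule growth_ballD(1)[OF f(2)])
      define F where "F i = (deriv ^^ i) f" for i :: nat
      have "cmod (F 0 (w + h) - (\<Sum>i\<le>1. F i w * ((w + h) - w) ^ i / fact i))
          \<le> B / r * cmod ((w + h) - w) ^ Suc 1 / fact 1"
      proof (rule complex_Taylor[of "cball w r"])
        fix i x assume "x \<in> cball w r"
        then have x: "x \<in> unit_disk" using r by blast
        have "F i holomorphic_on unit_disk"
          unfolding F_def by (rule holomorphic_higher_deriv[OF hf]) simp
        then have "(F i has_field_derivative deriv (F i) x) (at x)"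
          using x by (rule holomorphic_derivI[OF _ open_ball])
        then show "(F i has_field_derivative F (Suc i) x) (at x within cball w r)"
          by (simp add: F_def has_field_derivative_at_within)
      next
        fix x assume x: "x \<in> cball w r"
        have s: "cball x r \<subseteq> unit_disk" using sub[OF x] e(2) by blast
        have "norm ((deriv ^^ 1) (deriv f) x) \<le> fact 1 * B / r ^ 1"
        proof (rule Cauchy_inequality[OF _ _ r(1)])
          show "deriv f holomorphic_on ball x r"
            using hf' s ball_subset_cball by (meson holomorphic_on_subset order_trans)
          show "continuous_on (cball x r) (deriv f)"
            using holomorphic_on_imp_continuous_on[OF hf'] s by (rule continuous_on_subset)
          fix y assume "norm (x - y) = r"
          then have "y \<in> cball w e" using sub[OF x] by (auto simp: dist_norm)
          from B[OF f(2) this] show "norm (deriv f y) \<le> B" by simp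
        qed
        then show "cmod (F (Suc 1) x) \<le> B / r" by (simp add: F_def)
      qed (use r h in \<open>auto simp: dist_norm\<close>)
      then have "cmod (f (w + h) - f w - deriv f w * h) \<le> B / r * (cmod h)\<^sup>2"
        by (simp add: F_def diff_diff_eq power2_eq_square)
      moreover have "(f (w + h) - f w) / h - deriv f w = (f (w + h) - f w - deriv f w * h) / h"
        using h by (simp add: field_simps)
      ultimately show "cmod ((f (w + h) - f w) / h - deriv f w) \<le> B / r * cmod h"
        using h by (simp add: norm_divide divide_le_eq power2_eq_square mult.assoc)
    qed
  qed
qed

text \<open>
  Point evaluations are trivially continuous, and on the given set the derivative is a uniform
  limit of difference quotients. This avoids any explicit neighbourhood in the compact-open
  topology.
\<close>

lemma derivative_continuous_compact_open:
  assumes v: "weight v" and w: "w \<in> unit_disk" and B: "B \<subseteq> hol_disk"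
    "\<And>f. f \<in> B \<Longrightarrow> deriv f \<in> growth_ball v 1"
  shows "continuous_map (subtopology compact_open_topology B) euclidean (\<lambda>f. deriv f w)"
proof (rule difference_quotient_error[OF v w])
  fix r M
  assume r: "r > 0" "cball w r \<subseteq> unit_disk" and M: "\<And>f h. f \<in> hol_disk \<Longrightarrow>
    deriv f \<in> growth_ball v 1 \<Longrightarrow> h \<noteq> 0 \<Longrightarrow> cmod h \<le> r \<Longrightarrow>
    cmod ((f (w + h) - f w) / h - deriv f w) \<le> M * cmod h"
  define h where "h k = complex_of_real (r * inverse (real (Suc k)))" for k
  have h: "h k \<noteq> 0" "cmod (h k) \<le> r" for k
  proof -
    have "0 < r * inverse (real (Suc k))" "r * inverse (real (Suc k)) \<le> r"
      using r(1) by (auto simp: field_simps)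
    then show "h k \<noteq> 0" "cmod (h k) \<le> r"
      unfolding h_def norm_of_real of_real_eq_0_iff by auto
  qed
  have h0: "h \<longlonglongrightarrow> 0"
    unfolding h_def
    using tendsto_of_real[OF tendsto_mult_right_zero[OF LIMSEQ_inverse_real_of_nat, of r],
        where ?'a=complex] by simp
  show ?thesis
    unfolding mtopology_is_euclidean[symmetric]
  proof (rule Met_TC.continuous_map_uniform_limit[where F=sequentially
        and f="\<lambda>k f. (f (w + h k) - f w) / h k"])
    have "continuous_map (subtopology compact_open_topology B) euclidean
        (\<lambda>f. inverse (h k) * (f (w + h k) - f w))" for k
    proof -
      have "w + h k \<in> cball w r" using h(2)[of k] by (simp add: dist_norm)
      then have "w + h k \<in> unit_disk" using r(2) by blast
      then show ?thesis
        by (intro continuous_map_cmult continuous_map_diff evaluation_continuous_compact_open w B(1))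
    qed
    then show "\<forall>\<^sub>F k in sequentially. continuous_map (subtopology compact_open_topology B)
        Met_TC.mtopology (\<lambda>f. (f (w + h k) - f w) / h k)"
      by (simp add: divide_inverse mult.commute)
    fix e :: real assume "0 < e"
    have "(\<lambda>k. M * cmod (h k)) \<longlonglongrightarrow> M * cmod 0" by (intro tendsto_intros h0)
    then have "\<forall>\<^sub>F k in sequentially. M * cmod (h k) < e"
      using \<open>0 < e\<close> by (intro order_tendstoD(2)) auto
    then show "\<forall>\<^sub>F k in sequentially. \<forall>f\<in>topspace (subtopology compact_open_topology B).
        deriv f w \<in> UNIV \<and> dist ((f (w + h k) - f w) / h k) (deriv f w) < e"
    proof eventually_elim
      case (elim k)
      have "cmod ((f (w + h k) - f w) / h k - deriv f w) < e" if "f \<in> B" for f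
        using M[OF subsetD[OF B(1) that] B(2)[OF that] h, of k] elim by linarith
      then show ?case by (simp add: dist_norm)
    qed
  qed simp
qed

text \<open>
  On the unit ball the samples are at most 1 in modulus, so the tails of the \<open>\<ell>\<^sub>1\<close> sequence
  \<open>b\<close> bound the remainder of the defining series uniformly; its partial sums are continuous by
  the previous lemma.
\<close>

lemma sample_functional_in_predual:
  assumes v: "weight v" and z: "\<forall>n. z n \<in> unit_disk" and b: "b \<in> ell_one"
  shows "sample_functional v z b (bloch_inf_tilde v) \<in> predual_tilde v"
proof -
  let ?B = "{f \<in> bloch_inf_tilde v. bloch_norm v f \<le> 1}"
  let ?X = "subtopology compact_open_topology ?B"
  have "sample_functional v z b (bloch_inf_tilde v) \<in> dual_space (bloch_inf_tilde v) (bloch_norm v)"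
    by (rule sample_functional_in_dual_space[OF v z b])
      (auto simp: bloch_inf_tilde_def bloch_inf_add[OF v] bloch_inf_cmult)
  moreover have "continuous_map ?X euclidean (sample_functional v z b (bloch_inf_tilde v))"
    unfolding mtopology_is_euclidean[symmetric]
  proof (rule Met_TC.continuous_map_uniform_limit[where F=sequentially
        and f="\<lambda>N f. \<Sum>n<N. b n * interp_op v z f n"])
    have hol: "?B \<subseteq> hol_disk" by (auto simp: bloch_inf_tilde_def bloch_inf_def)
    have gb: "deriv f \<in> growth_ball v 1" if "f \<in> ?B" for f
      using deriv_bloch_in_growth_ball[of f v] that
      by (fastforce simp: bloch_inf_tilde_def growth_ball_def)
    have "continuous_map ?X euclidean (\<lambda>f. \<Sum>n<N. b n * interp_op v z f n)" for N
      unfolding interp_op_def using z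
      by (intro continuous_map_sum continuous_map_cmult
          derivative_continuous_compact_open[OF v _ hol gb]) auto
    then show "\<forall>\<^sub>F N in sequentially. continuous_map ?X Met_TC.mtopology
        (\<lambda>f. \<Sum>n<N. b n * interp_op v z f n)" by simp
    fix e :: real assume "0 < e"
    have sb: "summable (\<lambda>n. cmod (b n))" using b by (simp add: ell_one_def)
    from suminf_exist_split[OF \<open>0 < e\<close> sb]
    obtain N where N: "\<And>n. n \<ge> N \<Longrightarrow> norm (\<Sum>i. cmod (b (i + n))) < e" by blast
    have "dist (\<Sum>n<m. b n * interp_op v z f n) (sample_functional v z b (bloch_inf_tilde v) f) < e"
      if "m \<ge> N" "f \<in> ?B" for m f
    proof -
      have f: "f \<in> bloch_inf v" "bloch_norm v f \<le> 1"
        using that by (auto simp: bloch_inf_tilde_def)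
      have le1: "cmod (interp_op v z f n) \<le> 1" for n
        using norm_interp_op_le[OF v z f(1), of n] f(2) by linarith
      have bm: "(\<lambda>i. b (i + m)) \<in> ell_one" 
        using sb summable_iff_shift[where f="\<lambda>n. cmod (b n)" and k=m] by (simp add: ell_one_def)
      have "seq_pairing b (interp_op v z f) - (\<Sum>n<m. b n * interp_op v z f n) =
          (\<Sum>i. b (i + m) * interp_op v z f (i + m))"
        using suminf_split_initial_segment[where k=m, OF summable_seq_pairing[where a="interp_op v z f", OF b le1]]
        by (simp add: seq_pairing_def)
      moreover have "cmod (\<Sum>i. b (i + m) * interp_op v z f (i + m)) \<le> (\<Sum>i. cmod (b (i + m))) * 1"
        by (rule norm_seq_pairing_le[OF bm le1])
      ultimately show ?thesis
        using N[OF that(1)] that(2) by (simp add: sample_functional_def dist_norm norm_minus_commute)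
    qed
    then show "\<forall>\<^sub>F m in sequentially. \<forall>f\<in>topspace ?X.
        sample_functional v z b (bloch_inf_tilde v) f \<in> UNIV \<and>
        dist (\<Sum>n<m. b n * interp_op v z f n) (sample_functional v z b (bloch_inf_tilde v) f) < e"
      by (auto simp: eventually_sequentially intro!: exI[of _ N])
  qed simp
  ultimately show ?thesis by (simp add: predual_tilde_def)
qed

text \<open>
  The function that the definition of the pairing hands to the first component of a predual
  element.
\<close>

lemma minus_value_at_0:
  assumes f: "f \<in> bloch_inf v"
  defines "g \<equiv> (\<lambda>w. if w \<in> unit_disk then f w - f 0 else 0)"
  shows minus_value_at_0_in_tilde: "g \<in> bloch_inf_tilde v"
    and deriv_minus_value_at_0: "\<And>w. w \<in> unit_disk \<Longrightarrow> deriv g w = deriv f w"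
proof -
  have fh: "f \<in> hol_disk" using f by (simp add: bloch_inf_def)
  show d: "deriv g w = deriv f w" if w: "w \<in> unit_disk" for w
  proof -
    have "((\<lambda>x. f x - f 0) has_field_derivative deriv f w - 0) (at w)"
      using hol_disk_differentiable[OF fh w]
      by (intro derivative_intros) (simp add: field_differentiable_derivI)
    then have "(g has_field_derivative deriv f w - 0) (at w)"
      by (rule has_field_derivative_transform_within_open[OF _ open_ball w]) (simp add: g_def)
    then show ?thesis by (simp add: DERIV_imp_deriv)
  qed
  have "(\<lambda>x. f x - f 0) holomorphic_on unit_disk"
    using fh by (auto simp: hol_disk_def intro!: holomorphic_intros)
  then have "g holomorphic_on unit_disk"
    by (rule holomorphic_transform) (simp add: g_def)
  then have "g \<in> hol_disk" by (simp add: hol_disk_def g_def)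
  then have "g \<in> bloch_inf v"
    using bloch_infI[OF _ d deriv_bloch_in_growth_ball[OF f]] by blast
  then show "g \<in> bloch_inf_tilde v" by (simp add: bloch_inf_tilde_def g_def)
qed

lemma sample_functional_pairing:
  assumes z: "\<forall>n. z n \<in> unit_disk" and f: "f \<in> bloch_inf v"
  shows "bloch_pairing (sample_functional v z b (bloch_inf_tilde v), 0) f =
    seq_pairing b (interp_op v z f)"
proof -
  have "interp_op v z (\<lambda>w. if w \<in> unit_disk then f w - f 0 else 0) = interp_op v z f"
    using deriv_minus_value_at_0[OF f] z by (simp add: interp_op_def)
  then show ?thesis
    using minus_value_at_0_in_tilde[OF f]
    by (simp add: bloch_pairing_def sample_functional_def)
qed

section \<open>Predual elements are determined on the small space\<close>

definition dilation :: "real \<Rightarrow> (complex \<Rightarrow> complex) \<Rightarrow> (complex \<Rightarrow> complex)" where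
  "dilation r f = (\<lambda>w. if w \<in> unit_disk then f (of_real r * w) else 0)"

lemma deriv_dilation:
  assumes r: "0 \<le> r" "r \<le> 1" and f: "f \<in> hol_disk" and w: "w \<in> unit_disk"
  shows "(dilation r f has_field_derivative of_real r * deriv f (of_real r * w)) (at w)"
proof (rule has_field_derivative_transform_within_open[OF _ open_ball w])
  have "(f has_field_derivative deriv f (of_real r * w)) (at (of_real r * w))"
    using hol_disk_differentiable[OF f scaled_in_disk(1)[OF r w]]
    by (rule field_differentiable_derivI)
  moreover have "((\<lambda>w. of_real r * w) has_field_derivative of_real r) (at w)"
    by (auto intro!: derivative_eq_intros)
  ultimately show
    "((\<lambda>w. f (of_real r * w)) has_field_derivative of_real r * deriv f (of_real r * w)) (at w)"
    unfolding mult.commute[of "of_real r" "deriv f _"] by (rule DERIV_chain2)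
qed (simp add: dilation_def)

lemma dilation_bloch:
  assumes v: "typical_weight v" and r: "0 \<le> r" "r \<le> 1" and f: "f \<in> bloch_inf v"
  shows "dilation r f \<in> bloch_inf v" "bloch_norm v (dilation r f) \<le> bloch_norm v f"
    and "r < 1 \<Longrightarrow> dilation r f \<in> bloch_zero v"
proof -
  have wv: "weight v" using v by (simp add: typical_weight_def)
  have fh: "f \<in> hol_disk" using f by (simp add: bloch_inf_def)
  note d = DERIV_imp_deriv[OF deriv_dilation[OF r fh]]
  define C where "C = bloch_norm v f - cmod (f 0)"
  have fC: "deriv f \<in> growth_ball v C" unfolding C_def by (rule deriv_bloch_in_growth_ball[OF f])
  have "0 \<le> v 0 * cmod (deriv f 0)" using wv unfolding weight_def by (simp add: less_imp_le)
  also have "\<dots> \<le> C" using growth_ballD(2)[OF fC] by simp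
  finally have "C \<ge> 0" .
  have gC: "(\<lambda>w. of_real r * deriv f (of_real r * w)) \<in> growth_ball v (cmod (of_real r) * C)"
    by (intro growth_ball_cmult dilation_in_growth_ball v r fC)
  have "dilation r f holomorphic_on unit_disk"
    using deriv_dilation[OF r fh]
    by (meson has_field_derivative_at_within holomorphic_onI field_differentiable_def)
  then have "dilation r f \<in> hol_disk" by (simp add: hol_disk_def dilation_def)
  then show inf: "dilation r f \<in> bloch_inf v" by (rule bloch_infI[OF _ d gC])
  have "r * C \<le> C" using r \<open>C \<ge> 0\<close> by (simp add: mult_left_le_one_le)
  then show "bloch_norm v (dilation r f) \<le> bloch_norm v f"
    using bloch_norm_le[OF d gC] r by (simp add: C_def dilation_def)
  show "dilation r f \<in> bloch_zero v" if "r < 1"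
  proof -
    have "((\<lambda>w. of_real r * (of_real (v w) * deriv f (of_real r * w))) \<longlongrightarrow> 0) to_boundary"
      using dilation_vanishing_at_boundary[OF v r(1) that growth_ballD(1)[OF fC]]
      unfolding vanishing_at_boundary_def by (rule tendsto_mult_right_zero)
    then have "vanishing_at_boundary v (deriv (dilation r f))"
      unfolding vanishing_at_boundary_def
      by (rule Lim_transform_eventually)
        (use eventually_in_disk_to_boundary in eventually_elim, simp add: d)
    then show ?thesis using inf bloch_zero_iff[OF wv] by blast
  qed
qed

text \<open>
  Convergence in a generated topology needs to be checked on the subbase only.
\<close>

lemma eventually_in_generated_open:
  assumes "openin (topology_generated_by S) T" "x \<in> T"
    and sub: "\<And>s. s \<in> S \<Longrightarrow> x \<in> s \<Longrightarrow> \<forall>\<^sub>F k in F. y k \<in> s"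
  shows "\<forall>\<^sub>F k in F. y k \<in> T"
proof -
  have "generate_topology_on S T" using assms(1) by (rule openin_topology_generated_by)
  then show ?thesis using \<open>x \<in> T\<close>
  proof induction
    case (UN K)
    then obtain k where k: "k \<in> K" "x \<in> k" by blast
    from UN.IH[OF this] show ?case by eventually_elim (use k in blast)
  qed (auto simp: eventually_conj_iff intro: sub)
qed

lemma dilations_eventually_in_compact_open_nhd:
  assumes r: "\<And>k. 0 \<le> r k" "\<And>k. r k \<le> 1" "r \<longlonglongrightarrow> 1" and g: "g \<in> hol_disk"
    and T: "openin compact_open_topology T" "g \<in> T" and dil: "\<And>k. dilation (r k) g \<in> hol_disk"
  shows "\<forall>\<^sub>F k in sequentially. dilation (r k) g \<in> T"
proof (rule eventually_in_generated_open[OF T(1)[unfolded compact_open_topology_def] T(2)], clarify)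
  fix K U :: "complex set"
  assume K: "compact K" "K \<subseteq> unit_disk" and U: "open U" "g ` K \<subseteq> U"
  have "continuous_on unit_disk g"
    using g by (auto simp: hol_disk_def intro: holomorphic_on_imp_continuous_on)
  then have cont: "continuous_on (cball 0 s) g" if "s < 1" for s
    using that by (auto elim!: continuous_on_subset)
  obtain s where s: "s < 1" "K \<subseteq> cball 0 s"
  proof (cases "K = {}")
    case True
    then show ?thesis using that[of 0] by auto
  next
    case False
    obtain x where x: "x \<in> K" "\<forall>y\<in>K. norm y \<le> norm x"
      using continuous_attains_sup[OF K(1) False continuous_on_norm_id] by blast
    show ?thesis
      by (rule that[of "norm x"]) (use x K(2) in auto)
  qed
  have "compact (g ` K)"
    by (rule compact_continuous_image[OF continuous_on_subset[OF cont[OF s(1)] s(2)] K(1)])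
  then obtain e where e: "e > 0" "(\<Union>x\<in>g ` K. ball x e) \<subseteq> U"
    using compact_subset_open_imp_ball_epsilon_subset[OF _ U] by blast
  have "uniformly_continuous_on (cball 0 s) g"
    by (intro compact_uniformly_continuous cont s) auto
  then obtain d where d: "d > 0"
    "\<And>x y. x \<in> cball 0 s \<Longrightarrow> y \<in> cball 0 s \<Longrightarrow> dist y x < d \<Longrightarrow> dist (g y) (g x) < e"
    using \<open>e > 0\<close> unfolding uniformly_continuous_on_def by blast
  have "\<forall>\<^sub>F k in sequentially. dist (r k) 1 < d" using r(3) d(1) by (rule tendstoD)
  then show "\<forall>\<^sub>F k in sequentially. dilation (r k) g \<in> {f \<in> hol_disk. f ` K \<subseteq> U}"
  proof eventually_elim
    case (elim k)
    have "dilation (r k) g x \<in> U" if x: "x \<in> K" for x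
    proof -
      have xd: "x \<in> unit_disk" "x \<in> cball 0 s" using x K s by auto
      then have "of_real (r k) * x \<in> cball 0 s"
        using scaled_in_disk(2)[OF r(1,2) xd(1), of k] by simp
      moreover have "dist (of_real (r k) * x) x < d"
      proof -
        have "dist (of_real (r k) * x) x = cmod (of_real (r k - 1) * x)"
          by (simp add: dist_norm algebra_simps)
        also have "\<dots> \<le> \<bar>r k - 1\<bar> * 1"
          unfolding norm_mult norm_of_real using xd by (intro mult_left_mono) auto
        finally show ?thesis using elim by (simp add: dist_real_def)
      qed
      ultimately have "dist (g (of_real (r k) * x)) (g x) < e" using d(2) xd(2) by blast
      then have "g (of_real (r k) * x) \<in> U" using e(2) x by (force simp: dist_commute)
      then show ?thesis using xd by (simp add: dilation_def)
    qed
    then show ?case using dil by auto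
  qed
qed

text \<open>
  After normalisation, the dilations stay in the unit ball and converge there in the
  compact-open topology, for which the functional is continuous.
\<close>

lemma predual_tilde_dilation_tendsto:
  assumes v: "typical_weight v" and l: "l \<in> predual_tilde v" and g: "g \<in> bloch_inf_tilde v"
    and r: "\<And>k. 0 \<le> r k" "\<And>k. r k \<le> 1" "r \<longlonglongrightarrow> 1"
  shows "(\<lambda>k. l (dilation (r k) g)) \<longlonglongrightarrow> l g"
proof -
  let ?B = "{f \<in> bloch_inf_tilde v. bloch_norm v f \<le> 1}"
  have cont: "continuous_map (subtopology compact_open_topology ?B) euclidean l"
    and hom: "\<And>c f. f \<in> bloch_inf_tilde v \<Longrightarrow> l (\<lambda>x. c * f x) = c * l f"
    using l unfolding predual_tilde_def dual_space_def by blast+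
  have gi: "g \<in> bloch_inf v" "g 0 = 0" using g by (auto simp: bloch_inf_tilde_def)
  have dg: "dilation (r k) g \<in> bloch_inf_tilde v" "bloch_norm v (dilation (r k) g) \<le> bloch_norm v g" for k
    using dilation_bloch[OF v r(1,2) gi(1), of k] gi(2)
    by (auto simp: bloch_inf_tilde_def dilation_def)
  \<comment> \<open>Continuity of \<open>l\<close> is only known on the unit ball, so everything is divided by \<open>c\<close>.\<close>
  define c where "c = \<bar>bloch_norm v g\<bar> + 1"
  have c: "c > 0" "bloch_norm v g \<le> c" by (auto simp: c_def)
  define G where "G = (\<lambda>x. of_real (1 / c) * g x)"
  have dG: "dilation (r k) G = (\<lambda>x. of_real (1 / c) * dilation (r k) g x)" for k
    by (auto simp: dilation_def G_def)
  have inB: "(\<lambda>x. of_real (1 / c) * f x) \<in> ?B"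
    if f: "f \<in> bloch_inf_tilde v" "bloch_norm v f \<le> c" for f
  proof -
    have fi: "f \<in> bloch_inf v" "f 0 = 0" using f(1) by (auto simp: bloch_inf_tilde_def)
    have "bloch_norm v (\<lambda>x. of_real (1 / c) * f x) \<le> cmod (of_real (1 / c)) * bloch_norm v f"
      by (rule bloch_inf_cmult(3)[OF fi(1)])
    also have "\<dots> = bloch_norm v f / c" using c(1) by (simp add: norm_divide)
    also have "\<dots> \<le> 1" using f(2) c(1) by simp
    finally have "bloch_norm v (\<lambda>x. of_real (1 / c) * f x) \<le> 1" .
    moreover have "(\<lambda>x. of_real (1 / c) * f x) \<in> bloch_inf_tilde v"
      unfolding bloch_inf_tilde_def mem_Collect_eq
      using bloch_inf_cmult(1)[OF fi(1), of "of_real (1 / c)"] fi(2) by simp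
    ultimately show ?thesis by blast
  qed
  have GB: "G \<in> ?B" unfolding G_def using inB[OF g c(2)] .
  have GkB: "dilation (r k) G \<in> ?B" for k
    unfolding dG using inB[OF dg(1)] dg(2)[of k] c(2) by (meson order_trans)
  have hol: "f \<in> hol_disk" if "f \<in> ?B" for f
    using that by (auto simp: bloch_inf_tilde_def bloch_inf_def)
  have "(\<lambda>k. l (dilation (r k) G)) \<longlonglongrightarrow> l G"
  proof (rule topological_tendstoI)
    fix U assume U: "open U" "l G \<in> U"
    let ?X = "subtopology compact_open_topology ?B"
    have top: "f \<in> topspace ?X" if "f \<in> ?B" for f
    proof -
      have "{h \<in> hol_disk. h ` {} \<subseteq> UNIV} \<subseteq> topspace compact_open_topology"
        unfolding compact_open_topology_def
        by (intro openin_subset topology_generated_by_Basis CollectI exI[of _ "{}"] exI[of _ UNIV]) auto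
      then show ?thesis using hol[OF that] that by auto
    qed
    have "openin ?X {f \<in> topspace ?X. l f \<in> U}"
      using cont U(1) unfolding continuous_map_def by auto
    then obtain T where T: "openin compact_open_topology T" "{f \<in> topspace ?X. l f \<in> U} = T \<inter> ?B"
      unfolding openin_subtopology by blast
    have "G \<in> T" using T(2) U(2) top[OF GB] by blast
    then have "\<forall>\<^sub>F k in sequentially. dilation (r k) G \<in> T"
      using hol[OF GB] hol[OF GkB] by (intro dilations_eventually_in_compact_open_nhd r T(1))
    then show "\<forall>\<^sub>F k in sequentially. l (dilation (r k) G) \<in> U"
    proof eventually_elim
      case (elim k)
      then have "dilation (r k) G \<in> T \<inter> ?B" using GkB by blast
      then show ?case unfolding T(2)[symmetric] by blast
    qed
  qed
  then have "(\<lambda>k. of_real (1 / c) * l (dilation (r k) g)) \<longlonglongrightarrow> of_real (1 / c) * l g"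
    unfolding dG hom[OF dg(1)] unfolding G_def hom[OF g] .
  from tendsto_mult_left[OF this, of "of_real c"] show ?thesis
    using c(1) by simp
qed

lemma bloch_pairing_dilation_tendsto:
  assumes v: "typical_weight v" and u: "u \<in> bloch_predual v" and f: "f \<in> bloch_inf v"
    and r: "\<And>k. 0 \<le> r k" "\<And>k. r k \<le> 1" "r \<longlonglongrightarrow> 1"
  shows "(\<lambda>k. bloch_pairing u (dilation (r k) f)) \<longlonglongrightarrow> bloch_pairing u f"
proof -
  define g where "g = (\<lambda>w. if w \<in> unit_disk then f w - f 0 else 0)"
  have fh: "f \<in> hol_disk" using f by (simp add: bloch_inf_def)
  have g: "g \<in> bloch_inf_tilde v"
    unfolding g_def by (rule minus_value_at_0_in_tilde[OF f])
  have eq: "(\<lambda>w. if w \<in> unit_disk then dilation (r k) f w - dilation (r k) f 0 else 0) =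
      dilation (r k) g" for k
    using scaled_in_disk(1)[OF r(1,2)] by (auto simp: dilation_def g_def fun_eq_iff)
  have "(\<lambda>k. fst u (dilation (r k) g) + snd u * f 0) \<longlonglongrightarrow> fst u g + snd u * f 0"
    using u by (intro tendsto_intros predual_tilde_dilation_tendsto[OF v _ g r])
      (auto simp: bloch_predual_def)
  then show ?thesis
    unfolding bloch_pairing_def eq unfolding g_def[symmetric] by (simp add: dilation_def)
qed

text \<open>
  Restriction to the small space is injective on the predual, because every \<open>f\<close> is a limit of
  its dilations, which lie in the small space. In the definition of \<open>to_bidual\<close> the
  representative of a functional is picked by \<open>inv_into\<close>; injectivity is what allows it to be
  replaced by an explicit one.
\<close>

lemma bloch_predual_determined_by_bloch_zero:
  assumes v: "typical_weight v" and u: "u \<in> bloch_predual v" "u' \<in> bloch_predual v"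
    and eq: "restrict_functional bloch_pairing (bloch_zero v) u =
      restrict_functional bloch_pairing (bloch_zero v) u'"
    and f: "f \<in> bloch_inf v"
  shows "bloch_pairing u f = bloch_pairing u' f"
proof -
  define r where "r k = 1 - inverse (real (Suc k))" for k
  have r: "0 \<le> r k" "r k \<le> 1" "r k < 1" "r \<longlonglongrightarrow> 1" for k
    using radii_bounds[of k] radii_tendsto by (simp_all add: r_def[abs_def])
  have same: "bloch_pairing u (dilation (r k) f) = bloch_pairing u' (dilation (r k) f)" for k
    using fun_cong[OF eq, of "dilation (r k) f"] dilation_bloch(3)[OF v r(1,2) f r(3)]
    by (simp add: restrict_functional_def)
  show ?thesis
    using bloch_pairing_dilation_tendsto[OF v u(1) f r(1,2,4)]
      bloch_pairing_dilation_tendsto[OF v u(2) f r(1,2,4)]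
    unfolding same by (rule LIMSEQ_unique)
qed

section \<open>The second adjoint and weak-star continuity\<close>

text \<open>
  A functional on \<open>c\<^sub>0\<close> is given by some \<open>b\<close> in \<open>\<ell>\<^sub>1\<close>. The adjoint sends it to the sampling
  functional with coefficients \<open>b\<close>, which is the restriction of an element of the predual
  whose value at \<open>f\<close> is the pairing of \<open>b\<close> with the samples of \<open>f\<close>. Both sides of the equation
  are this number.
\<close>

lemma biadjoint_interp_op:
  assumes v: "typical_weight v" and z: "\<forall>n. z n \<in> unit_disk"
    and z1: "(\<lambda>n. cmod (z n)) \<longlonglongrightarrow> 1" and f: "f \<in> bloch_inf v"
  shows "op_biadjoint (bloch_zero v) c_zero sup_norm (interp_op v z)
            (to_bidual (bloch_predual v) bloch_pairing (bloch_zero v) (bloch_norm v) f)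
          = to_bidual ell_one seq_pairing c_zero sup_norm (interp_op v z f)"
proof
  fix \<psi>
  have wv: "weight v" using v by (simp add: typical_weight_def)
  let ?R = "restrict_functional bloch_pairing (bloch_zero v)"
  show "op_biadjoint (bloch_zero v) c_zero sup_norm (interp_op v z)
            (to_bidual (bloch_predual v) bloch_pairing (bloch_zero v) (bloch_norm v) f) \<psi>
          = to_bidual ell_one seq_pairing c_zero sup_norm (interp_op v z f) \<psi>"
  proof (cases "\<psi> \<in> dual_space c_zero sup_norm")
    case True
    define b where "b = inv_into ell_one (restrict_functional seq_pairing c_zero) \<psi>"
    have b: "b \<in> ell_one" "restrict_functional seq_pairing c_zero b = \<psi>"
      unfolding b_def using dual_of_c_zero_is_ell_one[OF True]
      by (rule inv_into_into, rule f_inv_into_f)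
    have sub: "bloch_zero v \<subseteq> bloch_inf v" by (auto simp: bloch_zero_def)
    define \<phi> where "\<phi> = sample_functional v z b (bloch_zero v)"
    have adj: "op_adjoint (bloch_zero v) (interp_op v z) \<psi> = \<phi>"
      unfolding op_adjoint_def \<phi>_def sample_functional_def b(2)[symmetric] restrict_functional_def
      using interp_op_bloch_zero[OF wv z z1] by auto
    have dual: "\<phi> \<in> dual_space (bloch_zero v) (bloch_norm v)"
      unfolding \<phi>_def
      by (intro sample_functional_in_dual_space[OF wv z b(1)] bloch_zero_add[OF wv]
          bloch_zero_cmult[OF wv] sub)
    define u0 where "u0 = (sample_functional v z b (bloch_inf_tilde v), 0::complex)"
    have u0: "u0 \<in> bloch_predual v"
      using sample_functional_in_predual[OF wv z b(1)] by (simp add: u0_def bloch_predual_def)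
    have u0_pair: "bloch_pairing u0 g = seq_pairing b (interp_op v z g)" if "g \<in> bloch_inf v" for g
      unfolding u0_def by (rule sample_functional_pairing[OF z that])
    have Ru0: "?R u0 = \<phi>"
    proof
      fix g show "?R u0 g = \<phi> g"
        using u0_pair[of g] sub
        by (cases "g \<in> bloch_zero v") (auto simp: restrict_functional_def \<phi>_def sample_functional_def)
    qed
    define u where "u = inv_into (bloch_predual v) ?R \<phi>"
    have "\<phi> \<in> ?R ` bloch_predual v" using u0 Ru0 by blast
    then have u: "u \<in> bloch_predual v" "?R u = \<phi>"
      unfolding u_def by (rule inv_into_into, rule f_inv_into_f)
    have "bloch_pairing u f = bloch_pairing u0 f"
      by (rule bloch_predual_determined_by_bloch_zero[OF v u(1) u0 _ f]) (simp add: u(2) Ru0)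
    then show ?thesis
      using True dual u0_pair[OF f]
      unfolding op_biadjoint_def op_adjoint_def[of "dual_space c_zero sup_norm"] to_bidual_def adj
        b_def[symmetric] u_def[symmetric] by simp
  next
    case False
    then show ?thesis by (simp add: op_biadjoint_def op_adjoint_def to_bidual_def)
  qed
qed

text \<open>
  The preimage of a subbasic open set given by \<open>b\<close> is the subbasic open set given by the
  sampling functional with coefficients \<open>b\<close>.
\<close>

lemma interp_op_weak_star_continuous:
  assumes v: "weight v" and z: "\<forall>n. z n \<in> unit_disk"
  shows "continuous_map
        (weak_star_topology (bloch_inf v) (bloch_predual v) bloch_pairing)
        (weak_star_topology ell_inf ell_one seq_pairing)
        (interp_op v z)"
proof -
  let ?X = "weak_star_topology (bloch_inf v) (bloch_predual v) bloch_pairing"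
  have op: "openin ?X {f \<in> bloch_inf v. bloch_pairing u f \<in> U}"
    if "u \<in> bloch_predual v" "open U" for u U
    unfolding weak_star_topology_def using that by (intro topology_generated_by_Basis) blast
  have top: "topspace ?X \<subseteq> bloch_inf v"
    unfolding weak_star_topology_def topology_generated_by_topspace by blast
  show ?thesis
    unfolding weak_star_topology_def[of ell_inf]
  proof (rule continuous_on_generated_topo)
    fix W assume "W \<in> {{a \<in> ell_inf. seq_pairing b a \<in> U} | b U. b \<in> ell_one \<and> open U}"
    then obtain b U where W: "W = {a \<in> ell_inf. seq_pairing b a \<in> U}" "b \<in> ell_one" "open U"
      by blast
    let ?u = "(sample_functional v z b (bloch_inf_tilde v), 0)"
    have "?u \<in> bloch_predual v"
      using sample_functional_in_predual[OF v z W(2)] by (simp add: bloch_predual_def)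
    from op[OF this W(3)] have o: "openin ?X {f \<in> bloch_inf v. bloch_pairing ?u f \<in> U}" .
    have "interp_op v z -` W \<inter> topspace ?X = {f \<in> bloch_inf v. bloch_pairing ?u f \<in> U}"
    proof (intro set_eqI iffI)
      fix f assume "f \<in> interp_op v z -` W \<inter> topspace ?X"
      then show "f \<in> {f \<in> bloch_inf v. bloch_pairing ?u f \<in> U}"
        using top sample_functional_pairing[OF z, of f v b] by (auto simp: W(1))
    next
      fix f assume f: "f \<in> {f \<in> bloch_inf v. bloch_pairing ?u f \<in> U}"
      then have "f \<in> topspace ?X" using openin_subset[OF o] by blast
      then show "f \<in> interp_op v z -` W \<inter> topspace ?X"
        using f interp_op_bloch_inf[OF v z, of f] sample_functional_pairing[OF z, of f v b]
        by (simp add: W(1))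
    qed
    then show "openin ?X (interp_op v z -` W \<inter> topspace ?X)" using o by simp
  next
    have "(\<lambda>n. 0) \<in> ell_one" by (simp add: ell_one_def)
    then have "ell_inf \<subseteq> \<Union>{{a \<in> ell_inf. seq_pairing b a \<in> U} | b U. b \<in> ell_one \<and> open U}"
      by (intro Union_upper CollectI exI[of _ "\<lambda>n. 0"] exI[of _ UNIV]) simp
    moreover have "interp_op v z ` topspace ?X \<subseteq> ell_inf"
      using top interp_op_bloch_inf[OF v z] by (auto simp del: topology_generated_by_topspace)
    ultimately show "interp_op v z ` topspace ?X \<subseteq>
        \<Union>{{a \<in> ell_inf. seq_pairing b a \<in> U} | b U. b \<in> ell_one \<and> open U}"
      by (rule order_trans[rotated])
  qed
qed

theorem corollary2p2:
  fixes v :: "complex \<Rightarrow> real" and z :: "nat \<Rightarrow> complex"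
  assumes "typical_weight v" and "\<forall>n. z n \<in> unit_disk"
  shows "(interpolating v z \<longleftrightarrow> c0_interpolating v z) \<and>
    ((\<lambda>n. cmod (z n)) \<longlonglongrightarrow> 1 \<longrightarrow>
      interp_op v z ` bloch_inf v \<subseteq> ell_inf \<and>
      interp_op v z ` bloch_zero v \<subseteq> c_zero \<and>
      (\<forall>f\<in>bloch_inf v.
        op_biadjoint (bloch_zero v) c_zero sup_norm (interp_op v z)
            (to_bidual (bloch_predual v) bloch_pairing (bloch_zero v) (bloch_norm v) f)
          = to_bidual ell_one seq_pairing c_zero sup_norm (interp_op v z f)) \<and>
      continuous_map
        (weak_star_topology (bloch_inf v) (bloch_predual v) bloch_pairing)
        (weak_star_topology ell_inf ell_one seq_pairing)
        (interp_op v z))"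
proof -
  have v: "weight v" using assms(1) by (simp add: typical_weight_def)
  show ?thesis
  proof (intro conjI impI ballI image_subsetI)
    show "interpolating v z \<longleftrightarrow> c0_interpolating v z"
      by (rule interpolating_iff_c0_interpolating[OF assms])
  qed (intro interp_op_bloch_inf[OF v assms(2)] interp_op_bloch_zero[OF v assms(2)]
      biadjoint_interp_op[OF assms] interp_op_weak_star_continuous[OF v assms(2)]; assumption)+
qed

end
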